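(* Let $\lambda>0$, let $\mu,\nu\in P_2(\mathbb{R}^d)$ be absolutely continuous with respect to Lebesgue measure with non-negative densities $f$ and $g$, and let $\varphi:\mathbb{R}^d\to\mathbb{R}$ be such that $(\mu,\nu,\varphi)$ is $\lambda$-regular; let $T=\nabla\varphi$ be the optimal transport map from $\mu$ to $\nu$ and $\gamma=(\mathrm{id},T)_\#\mu$ the induced optimal transport plan. Let $X,Y\subset\mathbb{R}^d$ be Borel sets on which $\mu$ and $\nu$, respectively, are concentrated. Let $C_1,C_2>0$. Then there is a constant $C$ depending only on $(\mu,\nu,C_1,C_2)$ such that the following holds for every $0<h\le\min\{\lambda,\lambda^{-1}\}$. Let $\mu_h=\sum_{i=1}^Nf_i\delta_{x_i}$ and $\nu_h=\sum_{j=1}^Mg_j\delta_{y_j}$ be probability measures with distinct nodes $x_i\in X$, distinct nodes $y_j\in Y$, and weights $f_i,g_j>0$, satisfying $$W_2(\mu,\mu_h)\le C_1h,\qquad W_2(\nu,\nu_h)\le C_1h,$$ and let $\gamma_h=\sum_{i=1}^{N}\sum_{j=1}^{M}\gamma_{h,ij}\,\delta_{x_i}\delta_{y_j}\in\Pi(\mu_h,\nu_h)$ be a discrete transport plan such that $$\Big(\sum_{i=1}^{N}\sum_{j=1}^{M}\gamma_{h,ij}\,c_{ij}\Big)^{1/2}-W_2(\mu_h,\nu_h)\le C_2h,\qquad c_{ij}:=|x_i-y_j|^2.$$ Then $$\Big(\int_{X\times Y}|T(x)-y|^2\,d\gamma_h(x,y)\Big)^{1/2}=\Big(\sum_{i=1}^{N}\sum_{j=1}^{M}\gamma_{h,ij}|T(x_i)-y_j|^2\Big)^{1/2}\le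 C\lambda^{1/2}h^{1/2},$$ $$W_2(\gamma,\gamma_h)\le C\lambda^{1/2}h^{1/2},$$ and the map $T_h$ defined on the nodes by $T_h(x_i):=\frac1{f_i}\sum_{j=1}^M\gamma_{h,ij}\,y_j$ satisfies $$\Big(\sum_{i=1}^Nf_i\,|T(x_i)-T_h(x_i)|^2\Big)^{1/2}\le C\lambda^{1/2}h^{1/2}.$$
   Context: $P_2(\mathbb{R}^n)$ is the set of Borel probability measures on $\mathbb{R}^n$ with finite second moment. $\Pi(\mu,\nu)$ is the set of transport plans, i.e. Borel probability measures on the product space with first marginal $\mu$ and second marginal $\nu$. $\delta_{x_i}\delta_{y_j}$ denotes the Dirac mass at $(x_i,y_j)$, so $\gamma_h\in\Pi(\mu_h,\nu_h)$ means $\gamma_{h,ij}\ge0$, $\sum_i\gamma_{h,ij}=g_j$, $\sum_j\gamma_{h,ij}=f_i$. $W_2(\mu,\nu)=\big(\min_{\gamma\in\Pi(\mu,\nu)}\int|x-y|^2\,d\gamma(x,y)\big)^{1/2}$ is the quadratic Wasserstein distance (used on $P_2(\mathbb{R}^d)$, and on $P_2(\mathbb{R}^{2d})$ for $W_2(\gamma,\gamma_h)$). A map $T$ is an optimal transport map from $\mu$ to $\nu$ if $T_\#\mu=\nu$ and $T$ minimizes $\int|x-S(x)|^2\,d\mu(x)$ among all measurable maps $S$ with $S_\#\mu=\nu$. $\lambda$-regularity: $(\mu,\nu,\varphi)$ is $\lambda$-regular ($\lambda>0$) if $\varphi:\mathbb{R}^d\to\mathbb{R}$ is convex, $\nabla\varphi$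 is the optimal transport map from $\mu$ to $\nu$ (for the quadratic cost), and $\varphi$ is $\lambda$-smooth, meaning $$\varphi((1-t)x_0+tx_1)+\frac{t(1-t)\lambda}{2}|x_0-x_1|^2\ge(1-t)\varphi(x_0)+t\varphi(x_1)$$ for all $x_0,x_1\in\mathbb{R}^d$, $t\in[0,1]$; equivalently, $\frac{\lambda}{2}|x|^2-\varphi(x)$ is convex. (Such a $\varphi$ is differentiable everywhere, so $T=\nabla\varphi$ is defined on all of $\mathbb{R}^d$.) *)

theory Defs
  imports "HOL-Probability.Probability"
begin

definition P2 :: "'a::euclidean_space measure set" where
  "P2 = {\<mu>. prob_space \<mu> \<and> sets \<mu> = sets borel \<and> integrable \<mu> (\<lambda>x. (norm x)\<^sup>2)}"

definition transport_plans ::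
  "'a::euclidean_space measure \<Rightarrow> 'b::euclidean_space measure \<Rightarrow> ('a \<times> 'b) measure set" where
  "transport_plans \<mu> \<nu> =
    {\<gamma>. prob_space \<gamma> \<and> sets \<gamma> = sets borel \<and> distr \<gamma> borel fst = \<mu> \<and> distr \<gamma> borel snd = \<nu>}"

text \<open>For measures in \<^const>\<open>P2\<close> the infimum is finite and attained, so it is the usual minimum.
  Outside \<^const>\<open>P2\<close> the value is not meaningful (\<^const>\<open>enn2real\<close> sends infinity to 0).\<close>

definition W2 :: "'a::euclidean_space measure \<Rightarrow> 'a measure \<Rightarrow> real" where
  "W2 \<mu> \<nu> = sqrt (enn2real
    (INF \<gamma>\<in>transport_plans \<mu> \<nu>. \<integral>\<^sup>+ z. ennreal ((norm (fst z - snd z))\<^sup>2) \<partial>\<gamma>))"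

definition is_optimal_transport_map ::
  "'a::euclidean_space measure \<Rightarrow> 'a measure \<Rightarrow> ('a \<Rightarrow> 'a) \<Rightarrow> bool" where
  "is_optimal_transport_map \<mu> \<nu> T \<longleftrightarrow>
    T \<in> borel_measurable \<mu> \<and> distr \<mu> borel T = \<nu> \<and>
    (\<forall>S. S \<in> borel_measurable \<mu> \<and> distr \<mu> borel S = \<nu> \<longrightarrow>
      (\<integral>\<^sup>+ x. ennreal ((norm (x - T x))\<^sup>2) \<partial>\<mu>) \<le> (\<integral>\<^sup>+ x. ennreal ((norm (x - S x))\<^sup>2) \<partial>\<mu>))"

text \<open>Meaningful only where the function is differentiable; in \<open>lambda_regular\<close> below, convexity
  and smoothness together make it differentiable everywhere.\<close>

definition gradient :: "('a::euclidean_space \<Rightarrow> real) \<Rightarrow> 'a \<Rightarrow> 'a" where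
  "gradient \<phi> x = (THE v. GDERIV \<phi> x :> v)"

definition lambda_smooth :: "real \<Rightarrow> ('a::euclidean_space \<Rightarrow> real) \<Rightarrow> bool" where
  "lambda_smooth lam \<phi> \<longleftrightarrow>
    (\<forall>x0 x1. \<forall>t\<in>{0..1}.
      \<phi> ((1 - t) *\<^sub>R x0 + t *\<^sub>R x1) + t * (1 - t) * lam / 2 * (norm (x0 - x1))\<^sup>2
        \<ge> (1 - t) * \<phi> x0 + t * \<phi> x1)"

definition lambda_regular ::
  "real \<Rightarrow> 'a::euclidean_space measure \<Rightarrow> 'a measure \<Rightarrow> ('a \<Rightarrow> real) \<Rightarrow> bool" where
  "lambda_regular lam \<mu> \<nu> \<phi> \<longleftrightarrow>
    lam > 0 \<and> convex_on UNIV \<phi> \<and>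
    is_optimal_transport_map \<mu> \<nu> (gradient \<phi>) \<and> lambda_smooth lam \<phi>"

text \<open>The discrete measure \<open>\<Sum>i\<in>I. w i \<cdot> \<delta>\<^bsub>x i\<^esub>\<close>, for finite \<open>I\<close> and weights \<open>w \<ge> 0\<close> (negative
  weights are truncated to 0), as the push-forward of the weights along the node map.\<close>

definition discrete_measure ::
  "'i set \<Rightarrow> ('i \<Rightarrow> real) \<Rightarrow> ('i \<Rightarrow> 'a::euclidean_space) \<Rightarrow> 'a measure" where
  "discrete_measure I w x = distr (point_measure I (\<lambda>i. ennreal (w i))) borel x"

lemma emeasure_discrete_measure:
  assumes "finite I" "A \<in> sets borel"
  shows "emeasure (discrete_measure I w x) A
    = (\<Sum>i\<in>I. ennreal (w i) * emeasure (return borel (x i)) A)"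
proof -
  have m: "x \<in> measurable (point_measure I (\<lambda>i. ennreal (w i))) borel"
    by (simp add: measurable_point_measure_eq1)
  have "emeasure (discrete_measure I w x) A
      = emeasure (point_measure I (\<lambda>i. ennreal (w i))) (x -` A \<inter> I)"
    unfolding discrete_measure_def
    using emeasure_distr[OF m assms(2)] by (simp add: space_point_measure)
  also have "\<dots> = (\<Sum>i\<in>x -` A \<inter> I. ennreal (w i))"
    using assms(1) by (subst emeasure_point_measure_finite2) auto
  also have "\<dots> = (\<Sum>i\<in>I. ennreal (w i) * emeasure (return borel (x i)) A)"
    using assms by (intro sum.mono_neutral_cong_left) (auto simp: indicator_def)
  finally show ?thesis .
qed

end

theory Submission
  imports Defs
begin

text \<open>Near-optimal couplings of \<open>\<mu>\<close> with \<open>\<mu>\<^sub>h\<close> and of \<open>\<nu>\<close> with \<open>\<nu>\<^sub>h\<close> are glued to \<open>\<gamma>\<^sub>h\<close>, giving a law of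
  \<open>(x, x', y', y)\<close> under which \<open>(x, y)\<close> is a plan from \<open>\<mu>\<close> to \<open>\<nu>\<close> whose cost exceeds that of \<open>T\<close> by
  \<open>O(h)\<close>. By \<open>\<lambda>\<close>-smoothness the Kantorovich duality gap \<open>\<phi>(x) + \<phi>\<^sup>*(y) - x \<bullet> y\<close> dominates
  \<open>|T(x) - y|\<^sup>2 / (4\<lambda>)\<close>, so the excess cost controls the \<open>L\<^sup>2\<close> norm of \<open>T(x) - y\<close> by a multiple of
  \<open>(\<lambda>h)\<^sup>1\<^sup>/\<^sup>2\<close>. Since \<open>T\<close> is Lipschitz with constant \<open>2\<lambda>\<close>, replacing \<open>(x, y)\<close> by \<open>(x', y')\<close> costs only
  \<open>O(\<lambda>h + h)\<close>, which \<open>h \<le> min(\<lambda>, 1/\<lambda>)\<close> absorbs. The sharp constants (\<open>2\<lambda>\<close> in the gap, \<open>\<lambda>\<close> for the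
  Lipschitz bound) are not needed.\<close>

section \<open>Square-integrable functions\<close>

definition square_integrable :: "'b measure \<Rightarrow> ('b \<Rightarrow> 'a::euclidean_space) \<Rightarrow> bool" where
  "square_integrable M f \<longleftrightarrow> f \<in> borel_measurable M \<and> integrable M (\<lambda>x. (norm (f x))\<^sup>2)"

text \<open>The Bochner integral defaults to 0 when the square is not integrable, so the value is
  the genuine \<open>L\<^sup>2\<close> norm only together with
  \<open>square_integrable\<close>.\<close>

definition l2norm :: "'b measure \<Rightarrow> ('b \<Rightarrow> 'a::euclidean_space) \<Rightarrow> real" where
  "l2norm M f = sqrt (LINT x|M. (norm (f x))\<^sup>2)"

lemma l2norm_nonneg [simp]: "0 \<le> l2norm M f"
  by (simp add: l2norm_def)

lemma l2norm_power2: "(l2norm M f)\<^sup>2 = (LINT x|M. (norm (f x))\<^sup>2)"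
  by (simp add: l2norm_def)

lemma l2norm_minus_commute: "l2norm M (\<lambda>x. f x - g x) = l2norm M (\<lambda>x. g x - f x)"
  by (simp add: l2norm_def norm_minus_commute)

text \<open>Young's inequality with a free weight. Keeping \<open>s\<close> arbitrary allows it to
  be optimised after integration, which yields Minkowski's inequality.\<close>

lemma norm_add_power2_le:
  fixes a b :: "'a::real_normed_vector" and s :: real
  assumes "s > 0"
  shows "(norm (a + b))\<^sup>2 \<le> (1 + s) * (norm a)\<^sup>2 + (1 + 1 / s) * (norm b)\<^sup>2"
proof -
  have "2 * norm a * norm b \<le> s * (norm a)\<^sup>2 + (norm b)\<^sup>2 / s"
  proof -
    have "0 \<le> (s * norm a - norm b)\<^sup>2 / s" using assms by simp
    also have "\<dots> = s * (norm a)\<^sup>2 + (norm b)\<^sup>2 / s - 2 * norm a * norm b"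
      using assms by (simp add: power2_diff field_simps power2_eq_square)
    finally show ?thesis by simp
  qed
  moreover have "(norm (a + b))\<^sup>2 \<le> (norm a + norm b)\<^sup>2"
    by (simp add: norm_triangle_ineq power_mono)
  ultimately show ?thesis
    by (simp add: power2_sum algebra_simps)
qed

lemma square_integrable_add:
  assumes "square_integrable M f" "square_integrable M g"
  shows "square_integrable M (\<lambda>x. f x + g x)"
proof -
  have [measurable]: "f \<in> borel_measurable M" "g \<in> borel_measurable M"
    using assms by (auto simp: square_integrable_def)
  have "integrable M (\<lambda>x. (norm (f x + g x))\<^sup>2)"
  proof (rule Bochner_Integration.integrable_bound)
    show "integrable M (\<lambda>x. 2 * (norm (f x))\<^sup>2 + 2 * (norm (g x))\<^sup>2)"
      using assms by (auto simp: square_integrable_def)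
    show "AE x in M. norm ((norm (f x + g x))\<^sup>2) \<le> norm (2 * (norm (f x))\<^sup>2 + 2 * (norm (g x))\<^sup>2)"
      using norm_add_power2_le[of 1 "f _" "g _"] by simp
  qed simp
  then show ?thesis by (simp add: square_integrable_def)
qed

lemma square_integrable_scaleR:
  assumes "square_integrable M f"
  shows "square_integrable M (\<lambda>x. c *\<^sub>R f x)"
  using assms by (auto simp: square_integrable_def power_mult_distrib)

lemma square_integrable_diff:
  assumes "square_integrable M f" "square_integrable M g"
  shows "square_integrable M (\<lambda>x. f x - g x)"
  using square_integrable_add[OF assms(1) square_integrable_scaleR[OF assms(2), of "-1"]] by simp

lemma l2norm_add_le:
  assumes f: "square_integrable M f" and g: "square_integrable M g"
  shows "l2norm M (\<lambda>x. f x + g x) \<le> l2norm M f + l2norm M g"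
proof -
  let ?a = "l2norm M f" and ?b = "l2norm M g"
  have *: "(l2norm M (\<lambda>x. f x + g x))\<^sup>2 \<le> (1 + s) * ?a\<^sup>2 + (1 + 1 / s) * ?b\<^sup>2" if "s > 0" for s :: real
  proof -
    have "(l2norm M (\<lambda>x. f x + g x))\<^sup>2 \<le> (LINT x|M. (1 + s) * (norm (f x))\<^sup>2 + (1 + 1 / s) * (norm (g x))\<^sup>2)"
      unfolding l2norm_power2
      using f g square_integrable_add[OF f g] norm_add_power2_le[OF that]
      by (intro integral_mono) (auto simp: square_integrable_def)
    also have "\<dots> = (1 + s) * ?a\<^sup>2 + (1 + 1 / s) * ?b\<^sup>2"
      unfolding l2norm_power2 using f g by (simp add: square_integrable_def)
    finally show ?thesis .
  qed
  \<comment> \<open>The optimal weight is the quotient of the two norms. Adding \<open>e\<close> to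
    both keeps the quotient defined when a norm vanishes.\<close>
  have eps: "(l2norm M (\<lambda>x. f x + g x)) \<le> (?a + e) + (?b + e)" if "e > 0" for e
  proof -
    let ?A = "?a + e" and ?B = "?b + e"
    have pos: "?A > 0" "?B > 0" using that by (auto simp: add_nonneg_pos)
    have "(l2norm M (\<lambda>x. f x + g x))\<^sup>2 \<le> (1 + ?B / ?A) * ?a\<^sup>2 + (1 + ?A / ?B) * ?b\<^sup>2"
      using *[of "?B / ?A"] pos by simp
    also have "\<dots> \<le> (1 + ?B / ?A) * ?A\<^sup>2 + (1 + ?A / ?B) * ?B\<^sup>2"
      using pos that by (intro add_mono mult_left_mono power_mono) auto
    also have "\<dots> = (?A + ?B)\<^sup>2"
    proof -
      have "(1 + ?B / ?A) * ?A\<^sup>2 = ?A * (?A + ?B)" "(1 + ?A / ?B) * ?B\<^sup>2 = ?B * (?A + ?B)"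
        using pos by (simp_all add: power2_eq_square divide_simps)
      then show ?thesis by (simp only: power2_eq_square distrib_right)
    qed
    finally show ?thesis
      using pos by (simp add: power2_le_iff_abs_le)
  qed
  show ?thesis
  proof (rule field_le_epsilon)
    fix e :: real assume "e > 0"
    then show "l2norm M (\<lambda>x. f x + g x) \<le> l2norm M f + l2norm M g + e"
      using eps[of "e / 2"] by simp
  qed
qed

lemma l2norm_mono:
  assumes "square_integrable M f" "square_integrable M g" "\<And>x. norm (f x) \<le> norm (g x)"
  shows "l2norm M f \<le> l2norm M g"
  unfolding l2norm_def using assms
  by (intro real_sqrt_le_mono integral_mono) (auto simp: square_integrable_def power_mono)

lemma l2norm_diff_le:
  assumes "square_integrable M f" "square_integrable M g" "square_integrable M h"
  shows "l2norm M (\<lambda>x. f x - h x) \<le> l2norm M (\<lambda>x. f x - g x) + l2norm M (\<lambda>x. g x - h x)"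
  using l2norm_add_le[OF square_integrable_diff[OF assms(1,2)] square_integrable_diff[OF assms(2,3)]]
  by simp

lemma l2norm_scaleR: "l2norm M (\<lambda>x. c *\<^sub>R f x) = \<bar>c\<bar> * l2norm M f"
  by (simp add: l2norm_def power_mult_distrib real_sqrt_mult)

lemma square_integrable_distr_iff:
  assumes "h \<in> measurable M borel" "f \<in> borel_measurable borel"
  shows "square_integrable (distr M borel h) f \<longleftrightarrow> square_integrable M (\<lambda>x. f (h x))"
  using assms measurable_compose[OF assms]
  by (simp add: square_integrable_def integrable_distr_eq)

lemma l2norm_distr:
  assumes "h \<in> measurable M borel" "f \<in> borel_measurable borel"
  shows "l2norm (distr M borel h) f = l2norm M (\<lambda>x. f (h x))"
  using assms by (simp add: l2norm_def integral_distr)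

lemma square_integrable_Pair:
  assumes "square_integrable M f" "square_integrable M g"
  shows "square_integrable M (\<lambda>x. (f x, g x))"
  using assms by (auto simp: square_integrable_def norm_Pair)

text \<open>Splits the distance on the product space into its two components, as needed for
  \<open>W2\<close> between plans.\<close>

lemma l2norm_Pair_le:
  assumes "square_integrable M f" "square_integrable M g"
  shows "l2norm M (\<lambda>x. (f x, g x)) \<le> l2norm M f + l2norm M g"
proof -
  have "l2norm M (\<lambda>x. (f x, g x)) = sqrt ((LINT x|M. (norm (f x))\<^sup>2) + (LINT x|M. (norm (g x))\<^sup>2))"
    using assms by (simp add: l2norm_def norm_Pair square_integrable_def)
  also have "\<dots> \<le> l2norm M f + l2norm M g"
    unfolding l2norm_def by (rule sqrt_add_le_add_sqrt) auto
  finally show ?thesis .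
qed

lemma square_integrable_inner:
  assumes "square_integrable M f" "square_integrable M g"
  shows "integrable M (\<lambda>x. f x \<bullet> g x)"
proof -
  have "(\<lambda>x. f x \<bullet> g x) = (\<lambda>x. ((norm (f x + g x))\<^sup>2 - (norm (f x))\<^sup>2 - (norm (g x))\<^sup>2) / 2)"
    by (intro ext dot_norm)
  then show ?thesis
    using assms square_integrable_add[OF assms] by (simp add: square_integrable_def)
qed

text \<open>With the marginals fixed, the two squared norms are fixed as well, so comparing
  quadratic costs amounts to comparing correlations.\<close>

lemma l2norm_diff_power2:
  assumes "square_integrable M f" "square_integrable M g"
  shows "(l2norm M (\<lambda>x. f x - g x))\<^sup>2
    = (l2norm M f)\<^sup>2 + (l2norm M g)\<^sup>2 - 2 * (LINT x|M. f x \<bullet> g x)"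
proof -
  have "(norm (f x - g x))\<^sup>2 = (norm (f x))\<^sup>2 + (norm (g x))\<^sup>2 - 2 * (f x \<bullet> g x)" for x
    by (simp add: power2_norm_eq_inner inner_diff_left inner_diff_right inner_commute)
  then show ?thesis
    unfolding l2norm_power2
    using assms square_integrable_inner[OF assms] by (simp add: square_integrable_def)
qed

lemma (in finite_measure) square_integrable_imp_integrable:
  assumes "square_integrable M f"
  shows "integrable M (\<lambda>x. norm (f x))"
proof (rule Bochner_Integration.integrable_bound)
  show "integrable M (\<lambda>x. 1 + (norm (f x))\<^sup>2)"
    using assms by (simp add: square_integrable_def)
  have "t \<le> 1 + t\<^sup>2" if "0 \<le> t" for t :: real
    using sum_squares_bound[of t 1] that by simp
  then show "AE x in M. norm (norm (f x)) \<le> norm (1 + (norm (f x))\<^sup>2)"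
    by simp
qed (use assms in \<open>auto simp: square_integrable_def\<close>)

lemma P2_square_integrable:
  assumes "\<mu> \<in> P2"
  shows "square_integrable \<mu> (\<lambda>x. x)"
  using assms by (simp add: P2_def square_integrable_def cong: measurable_cong_sets)

lemma square_integrable_of_marginal:
  assumes "h \<in> borel_measurable M" "distr M borel h \<in> P2"
  shows "square_integrable M h"
  using P2_square_integrable[OF assms(2)] square_integrable_distr_iff[OF assms(1), of "\<lambda>x. x"] by simp

section \<open>Smooth convex functions\<close>

text \<open>The point \<open>(x, \<phi> x)\<close> is separated from the strict epigraph; the normal
  \<open>(p, s)\<close> of the hyperplane turns out to have \<open>s > 0\<close>, and its slope is
  the subgradient.\<close>

lemma convex_subgradient_exists:
  fixes \<phi> :: "'a::euclidean_space \<Rightarrow> real"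
  assumes "convex_on UNIV \<phi>"
  shows "\<exists>v. \<forall>z. \<phi> x + v \<bullet> (z - x) \<le> \<phi> z"
proof -
  let ?S = "{z. \<phi> (fst z) < snd z}"
  have "convex ?S"
  proof (rule convexI)
    fix p q :: "'a \<times> real" and u v :: real
    assume pq: "p \<in> ?S" "q \<in> ?S" and uv: "0 \<le> u" "0 \<le> v" "u + v = 1"
    have "\<phi> (u *\<^sub>R fst p + v *\<^sub>R fst q) \<le> u * \<phi> (fst p) + v * \<phi> (fst q)"
      using assms uv unfolding convex_on_def by simp
    also have "\<dots> < u * snd p + v * snd q"
    proof (cases "u = 0")
      case False
      then have "u * \<phi> (fst p) < u * snd p" using pq uv by simp
      moreover have "v * \<phi> (fst q) \<le> v * snd q" using pq uv by (simp add: mult_left_mono)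
      ultimately show ?thesis by simp
    qed (use pq uv in simp)
    finally show "u *\<^sub>R p + v *\<^sub>R q \<in> ?S" by simp
  qed
  moreover have "(x, \<phi> x + 1) \<in> ?S" by simp
  ultimately obtain a b where a: "a \<noteq> 0" and ax: "a \<bullet> (x, \<phi> x) \<le> b"
    and aS: "\<And>z. z \<in> ?S \<Longrightarrow> b \<le> a \<bullet> z"
    using separating_hyperplane_sets[of "{(x, \<phi> x)}" ?S] by fastforce
  obtain p s where ps: "a = (p, s)" by fastforce
  have ineq: "p \<bullet> x + s * \<phi> x \<le> p \<bullet> z + s * r" if "\<phi> z < r" for z r
    using ax aS[of "(z, r)"] that ps by simp
  have "s \<ge> 0"
    using ineq[of x "\<phi> x + 1"] by (simp add: algebra_simps)
  moreover have "s \<noteq> 0"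
  proof
    assume s: "s = 0"
    \<comment> \<open>A vertical hyperplane is excluded by testing at \<open>x - p\<close>: this
      forces \<open>p = 0\<close>, hence a zero normal.\<close>
    then have "p \<bullet> x \<le> p \<bullet> (x - p)" using ineq[of "x - p" "\<phi> (x - p) + 1"] by simp
    then have "p \<bullet> p \<le> 0" by (simp add: inner_diff_right)
    then have "p = 0" by (metis inner_ge_zero inner_eq_zero_iff order_antisym)
    then show False using a ps s by (simp add: zero_prod_def)
  qed
  ultimately have s: "s > 0" by simp
  show ?thesis
  proof (intro exI[of _ "(- 1 / s) *\<^sub>R p"] allI)
    fix z
    show "\<phi> x + ((- 1 / s) *\<^sub>R p) \<bullet> (z - x) \<le> \<phi> z"
    \<comment> \<open>Only points strictly above the graph are available, so the height is
      \<open>\<phi> z + e\<close> and \<open>e\<close> tends to 0.\<close>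
    proof (rule field_le_epsilon)
      fix e :: real assume "e > 0"
      then have "s * \<phi> x - p \<bullet> (z - x) \<le> s * (\<phi> z + e)"
        using ineq[of z "\<phi> z + e"] by (simp add: inner_diff_right)
      then have "(s * \<phi> x - p \<bullet> (z - x)) / s \<le> \<phi> z + e"
        using s by (simp add: pos_divide_le_eq mult.commute)
      then show "\<phi> x + ((- 1 / s) *\<^sub>R p) \<bullet> (z - x) \<le> \<phi> z + e"
        using s by (simp add: diff_divide_distrib)
    qed
  qed
qed

section \<open>Quadratic upper bounds and the gradient of a smooth convex function\<close>

locale smooth_convex =
  fixes lam :: real and \<phi> :: "'a::euclidean_space \<Rightarrow> real"
  assumes lam_pos: "lam > 0"
    and convex: "convex_on UNIV \<phi>"
    and smooth: "lambda_smooth lam \<phi>"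
begin

lemma midpoint_upper:
  "\<phi> (x + d) + \<phi> (x - d) - 2 * \<phi> x \<le> lam * (norm d)\<^sup>2"
proof -
  have "\<phi> ((1 - 1/2) *\<^sub>R (x + d) + (1/2) *\<^sub>R (x - d)) + (1/2) * (1 - 1/2) * lam / 2 * (norm ((x + d) - (x - d)))\<^sup>2
      \<ge> (1 - 1/2) * \<phi> (x + d) + (1/2) * \<phi> (x - d)"
    using smooth unfolding lambda_smooth_def
    by (elim allE[of _ "x + d"] allE[of _ "x - d"] ballE[of _ _ "1/2"]) auto
  moreover have "(1 - 1/2 :: real) *\<^sub>R (x + d) + (1/2::real) *\<^sub>R (x - d) = x"
    by (simp add: scaleR_add_right scaleR_diff_right flip: scaleR_left_distrib)
  moreover have "(x + d) - (x - d) = 2 *\<^sub>R d" by (simp add: scaleR_2)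
  ultimately show ?thesis by (simp add: power_mult_distrib)
qed

text \<open>The subgradient inequality at the reflected point \<open>2 x - z\<close> bounds \<phi>
  from below there, and the midpoint form of smoothness turns this into an upper bound at
  \<open>z\<close>. Working with midpoints produces the factor \<open>lam\<close> instead of the
  sharp \<open>lam / 2\<close>.\<close>

lemma subgradient_upper:
  assumes "\<And>z. \<phi> x + v \<bullet> (z - x) \<le> \<phi> z"
  shows "\<phi> z \<le> \<phi> x + v \<bullet> (z - x) + lam * (norm (z - x))\<^sup>2"
  using midpoint_upper[of x "z - x"] assms[of "x - (z - x)"]
  by (simp add: inner_diff_right algebra_simps)

text \<open>Near \<open>x\<close> the function lies between an affine function and the same affine
  function plus a quadratic, so the slope of the affine function is the derivative.\<close>

lemma subgradient_GDERIV:
  assumes "\<And>z. \<phi> x + v \<bullet> (z - x) \<le> \<phi> z"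
  shows "GDERIV \<phi> x :> v"
  unfolding gderiv_def has_derivative_at_alt
proof (intro conjI allI impI)
  show "bounded_linear (\<lambda>h. h \<bullet> v)" by (rule bounded_linear_inner_left)
  fix e :: real assume e: "e > 0"
  show "\<exists>d>0. \<forall>y. norm (y - x) < d \<longrightarrow> norm (\<phi> y - \<phi> x - (y - x) \<bullet> v) \<le> e * norm (y - x)"
  proof (intro exI[of _ "e / lam"] conjI allI impI)
    show "e / lam > 0" using e lam_pos by simp
    fix y assume "norm (y - x) < e / lam"
    then have "lam * norm (y - x) \<le> e" using lam_pos by (simp add: field_simps)
    then have "lam * (norm (y - x))\<^sup>2 \<le> e * norm (y - x)"
      by (metis mult.assoc mult_right_mono norm_ge_zero power2_eq_square)
    then show "norm (\<phi> y - \<phi> x - (y - x) \<bullet> v) \<le> e * norm (y - x)"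
      using assms[of y] subgradient_upper[OF assms, of y] by (simp add: inner_commute)
  qed
qed

text \<open>Some subgradient exists and is a derivative by the preceding lemma; uniqueness of
  derivatives identifies it with the definite description in \<open>gradient\<close>.\<close>

lemma gradient_subgradient: "\<phi> x + gradient \<phi> x \<bullet> (z - x) \<le> \<phi> z"
proof -
  obtain v where v: "\<And>z. \<phi> x + v \<bullet> (z - x) \<le> \<phi> z"
    using convex_subgradient_exists[OF convex] by blast
  have D: "GDERIV \<phi> x :> v" using subgradient_GDERIV[OF v] .
  have "gradient \<phi> x = v"
    unfolding gradient_def
  proof (rule the_equality)
    fix w assume "GDERIV \<phi> x :> w"
    then have "(\<lambda>h. h \<bullet> w) = (\<lambda>h. h \<bullet> v)"
      using D unfolding gderiv_def by (rule has_derivative_unique)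
    then have "\<forall>h. h \<bullet> w = h \<bullet> v" by (simp add: fun_eq_iff)
    then show "w = v" unfolding vector_eq_ldot .
  qed (rule D)
  then show ?thesis using v[of z] by (simp only:)
qed

lemmas gradient_upper = subgradient_upper[OF gradient_subgradient]

lemma gradient_lipschitz:
  "norm (gradient \<phi> x - gradient \<phi> y) \<le> 2 * lam * norm (x - y)"
proof (cases "gradient \<phi> x = gradient \<phi> y \<or> x = y")
  case True
  then show ?thesis using lam_pos by auto
next
  case False
  let ?u = "gradient \<phi> x - gradient \<phi> y" and ?r = "norm (x - y)"
  \<comment> \<open>Moving from \<open>y\<close> in the direction of the gradient difference, by
    exactly the distance of \<open>x\<close> and \<open>y\<close>, makes the Cauchy-Schwarz
    inequality an equality. The lower bound at \<open>z\<close> from \<open>x\<close> then competes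
    with upper bounds at \<open>z\<close> from \<open>y\<close> and at \<open>y\<close> from
    \<open>x\<close>.\<close>
  define z where "z = y + (?r / norm ?u) *\<^sub>R ?u"
  have nz: "norm (z - y) = ?r" using False by (simp add: z_def)
  have "?u \<bullet> (z - y) = ?r * norm ?u"
    using False by (simp add: z_def dot_square_norm power2_eq_square)
  moreover have "?u \<bullet> (z - y) \<le> lam * ?r\<^sup>2 + lam * ?r\<^sup>2"
    using gradient_subgradient[of x z] gradient_upper[of z y] gradient_upper[of y x] nz
    by (simp add: inner_diff_right inner_diff_left norm_minus_commute)
  ultimately have "?r * norm ?u \<le> ?r * (2 * lam * ?r)" by (simp add: power2_eq_square algebra_simps)
  then show ?thesis using False by simp
qed

lemma continuous_on_gradient: "continuous_on UNIV (gradient \<phi>)"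
proof (rule lipschitz_on_continuous_on)
  show "(2 * lam)-lipschitz_on UNIV (gradient \<phi>)"
    using gradient_lipschitz lam_pos by (auto simp: lipschitz_on_def dist_norm)
qed

lemma gradient_measurable [measurable]: "gradient \<phi> \<in> borel_measurable borel"
  using continuous_on_gradient by (rule borel_measurable_continuous_onI)

lemma measurable_phi [measurable]: "\<phi> \<in> borel_measurable borel"
  using convex_on_continuous[OF open_UNIV convex] by (rule borel_measurable_continuous_onI)

text \<open>The affine minorant and quadratic majorant at the origin give quadratic growth, which
  finite second moments control.\<close>

lemma integrable_phi:
  assumes "\<mu> \<in> P2"
  shows "integrable \<mu> \<phi>"
proof -
  interpret prob_space \<mu> using assms by (simp add: P2_def)
  have sq: "square_integrable \<mu> (\<lambda>x. x)"
    using assms P2_square_integrable by blast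
  have meas: "\<phi> \<in> borel_measurable \<mu>"
    using assms by (simp add: P2_def cong: measurable_cong_sets)
  let ?b = "\<lambda>x. \<bar>\<phi> 0\<bar> + norm (gradient \<phi> 0) * norm x + lam * (norm x)\<^sup>2"
  show ?thesis
  proof (rule Bochner_Integration.integrable_bound)
    show "integrable \<mu> ?b"
      using sq square_integrable_imp_integrable[OF sq]
      by (intro Bochner_Integration.integrable_add integrable_const integrable_mult_right)
        (auto simp: square_integrable_def)
    show "AE x in \<mu>. norm (\<phi> x) \<le> norm (?b x)"
    proof (rule AE_I2)
      fix x
      have "\<bar>gradient \<phi> 0 \<bullet> x\<bar> \<le> norm (gradient \<phi> 0) * norm x"
        by (rule Cauchy_Schwarz_ineq2)
      moreover have "0 \<le> lam * (norm x)\<^sup>2" using lam_pos by simp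
      ultimately have "\<bar>\<phi> x\<bar> \<le> ?b x"
        using gradient_subgradient[of 0 x] gradient_upper[of x 0] by simp
      then show "norm (\<phi> x) \<le> norm (?b x)" by simp
    qed
  qed (rule meas)
qed

section \<open>Conjugate potential and duality gap\<close>

text \<open>The conjugate may be infinite, but not on the range of the gradient, which carries \<open>\<nu>\<close>.\<close>

lemma conjugate_exists:
  assumes \<mu>: "\<mu> \<in> P2" and T: "distr \<mu> borel (gradient \<phi>) = \<nu>" and \<nu>: "\<nu> \<in> P2"
  obtains \<psi> where "integrable \<nu> \<psi>"
    and "AE y in \<nu>. \<forall>z. z \<bullet> y - \<phi> z \<le> \<psi> y"
    and "(LINT y|\<nu>. \<psi> y) = (LINT x|\<mu>. x \<bullet> gradient \<phi> x) - (LINT x|\<mu>. \<phi> x)"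
proof -
  define \<Psi> :: "'a \<Rightarrow> ereal" where "\<Psi> y = (SUP z. ereal (z \<bullet> y - \<phi> z))" for y
  have [measurable]: "\<Psi> \<in> borel_measurable borel"
  \<comment> \<open>An uncountable supremum of continuous functions is lower semicontinuous: its
    strict superlevel sets are unions of open sets.\<close>
  proof (rule borel_measurableI_greater)
    fix a :: ereal
    have "{y. a < \<Psi> y} = (\<Union>z. (\<lambda>y. ereal (z \<bullet> y - \<phi> z)) -` {a<..})"
      by (auto simp: \<Psi>_def less_SUP_iff)
    moreover have "open ((\<lambda>y. ereal (z \<bullet> y - \<phi> z)) -` {a<..})" for z
      by (intro open_vimage open_greaterThan continuous_intros)
    ultimately have "open {y. a < \<Psi> y}" by auto
    then show "{y \<in> space borel. a < \<Psi> y} \<in> sets borel" by simp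
  qed
  \<comment> \<open>Equality in the Fenchel-Young inequality: the supremum is attained at
    \<open>x\<close> because \<open>gradient \<phi> x\<close> is a subgradient there.\<close>
  have range: "\<Psi> (gradient \<phi> x) = ereal (x \<bullet> gradient \<phi> x - \<phi> x)" for x
  proof (rule antisym)
    show "\<Psi> (gradient \<phi> x) \<le> ereal (x \<bullet> gradient \<phi> x - \<phi> x)"
      unfolding \<Psi>_def
    proof (rule SUP_least)
      fix z
      show "ereal (z \<bullet> gradient \<phi> x - \<phi> z) \<le> ereal (x \<bullet> gradient \<phi> x - \<phi> x)"
        using gradient_subgradient[of x z] by (simp add: inner_diff_right inner_commute)
    qed
    show "ereal (x \<bullet> gradient \<phi> x - \<phi> x) \<le> \<Psi> (gradient \<phi> x)"
      unfolding \<Psi>_def by (rule SUP_upper) simp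
  qed
  \<comment> \<open>\<open>real_of_ereal\<close> sends infinite values to 0, which would break the
    bound from below; these values form a null set for \<nu>, hence the almost-everywhere
    claim.\<close>
  define \<psi> where "\<psi> y = real_of_ereal (\<Psi> y)" for y
  have [measurable]: "\<psi> \<in> borel_measurable borel" unfolding \<psi>_def by measurable
  have s\<mu>: "sets \<mu> = sets borel" using \<mu> by (simp add: P2_def)
  have Tm: "gradient \<phi> \<in> measurable \<mu> borel"
    using s\<mu> by (simp cong: measurable_cong_sets)
  have sq: "square_integrable \<mu> (\<lambda>x. x)" using \<mu> P2_square_integrable by blast
  have sqT: "square_integrable \<mu> (gradient \<phi>)"
    using P2_square_integrable[OF \<nu>] square_integrable_distr_iff[OF Tm, of "\<lambda>y. y"] T by simp
  have int: "integrable \<mu> (\<lambda>x. x \<bullet> gradient \<phi> x)"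
    using square_integrable_inner[OF sq sqT] .
  have \<psi>T: "\<psi> (gradient \<phi> x) = x \<bullet> gradient \<phi> x - \<phi> x" for x
    by (simp add: \<psi>_def range)
  show ?thesis
  proof (rule that)
    show "integrable \<nu> \<psi>"
      unfolding T[symmetric] using int integrable_phi[OF \<mu>]
      by (subst integrable_distr_eq[OF Tm]) (auto simp: \<psi>T)
    show "(LINT y|\<nu>. \<psi> y) = (LINT x|\<mu>. x \<bullet> gradient \<phi> x) - (LINT x|\<mu>. \<phi> x)"
      unfolding T[symmetric] using int integrable_phi[OF \<mu>]
      by (subst integral_distr[OF Tm]) (auto simp: \<psi>T)
    have "AE y in \<nu>. \<Psi> y \<noteq> \<infinity>"
      unfolding T[symmetric] by (subst AE_distr_iff[OF Tm]) (auto simp: range)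
    then show "AE y in \<nu>. \<forall>z. z \<bullet> y - \<phi> z \<le> \<psi> y"
    proof (rule AE_mp, intro AE_I2 impI allI)
      fix y z assume "\<Psi> y \<noteq> \<infinity>"
      moreover have "ereal (z \<bullet> y - \<phi> z) \<le> \<Psi> y"
        unfolding \<Psi>_def by (rule SUP_upper) simp
      ultimately show "z \<bullet> y - \<phi> z \<le> \<psi> y"
        unfolding \<psi>_def by (cases "\<Psi> y") auto
    qed
  qed
qed

text \<open>Test the conjugate at \<open>x + (y - \<nabla>\<phi>(x)) / (2\<lambda>)\<close>, the maximiser of the quadratic lower bound.\<close>

lemma duality_gap_lower:
  assumes "\<forall>z. z \<bullet> y - \<phi> z \<le> c"
  shows "(norm (gradient \<phi> x - y))\<^sup>2 \<le> 4 * lam * (\<phi> x + c - x \<bullet> y)"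
proof -
  let ?e = "y - gradient \<phi> x"
  define z where "z = x + (1 / (2 * lam)) *\<^sub>R ?e"
  have zx: "z - x = (1 / (2 * lam)) *\<^sub>R ?e" by (simp add: z_def)
  have "z \<bullet> y - \<phi> z \<le> c" using assms by blast
  then have "(z - x) \<bullet> ?e - lam * (norm (z - x))\<^sup>2 \<le> \<phi> x + c - x \<bullet> y"
    using gradient_upper[of z x]
    by (simp add: inner_diff_right inner_diff_left inner_commute)
  moreover have "(z - x) \<bullet> ?e = (norm ?e)\<^sup>2 / (2 * lam)"
    unfolding zx by (simp add: dot_square_norm)
  moreover have "lam * (norm (z - x))\<^sup>2 = (norm ?e)\<^sup>2 / (4 * lam)"
    unfolding zx using lam_pos by (simp add: power_mult_distrib power_divide power2_eq_square)
  ultimately have "(norm ?e)\<^sup>2 / (4 * lam) \<le> \<phi> x + c - x \<bullet> y"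
    by (simp add: field_simps)
  then show ?thesis using lam_pos by (simp add: field_simps norm_minus_commute)
qed

text \<open>Integrating the pointwise gap replaces the potentials by the correlation of the identity
  and the gradient under \<mu>, by equality in duality. Second moments agree on both sides, so the
  deficit in correlation is half the excess cost, and \<open>4 * lam\<close> becomes
  \<open>2 * lam\<close>. The plan is given as a pair of random variables so that the bound applies
  directly on a glued space.\<close>

lemma l2norm_gradient_minus_plan:
  fixes p q :: "'b \<Rightarrow> 'a"
  assumes \<mu>: "\<mu> \<in> P2" and \<nu>: "\<nu> \<in> P2" and T: "distr \<mu> borel (gradient \<phi>) = \<nu>"
    and p[measurable]: "p \<in> measurable R borel" and q[measurable]: "q \<in> measurable R borel"
    and pR: "distr R borel p = \<mu>" and qR: "distr R borel q = \<nu>"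
  shows "(l2norm R (\<lambda>r. gradient \<phi> (p r) - q r))\<^sup>2
    \<le> 2 * lam * ((l2norm R (\<lambda>r. p r - q r))\<^sup>2 - (l2norm \<mu> (\<lambda>x. x - gradient \<phi> x))\<^sup>2)"
proof -
  obtain \<psi> where \<psi>i: "integrable \<nu> \<psi>"
    and \<psi>: "AE y in \<nu>. \<forall>z. z \<bullet> y - \<phi> z \<le> \<psi> y"
    and \<psi>I: "(LINT y|\<nu>. \<psi> y) = (LINT x|\<mu>. x \<bullet> gradient \<phi> x) - (LINT x|\<mu>. \<phi> x)"
    using conjugate_exists[OF \<mu> T \<nu>] .
  have s: "sets \<mu> = sets borel" "sets \<nu> = sets borel" using \<mu> \<nu> by (auto simp: P2_def)
  have Tm: "gradient \<phi> \<in> measurable \<mu> borel" using s by (simp cong: measurable_cong_sets)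
  have \<psi>m[measurable]: "\<psi> \<in> borel_measurable borel"
    using \<psi>i s by (simp add: integrable_iff_bounded cong: measurable_cong_sets)
  have sq: "square_integrable \<mu> (\<lambda>x. x)" "square_integrable \<nu> (\<lambda>x. x)"
    using \<mu> \<nu> P2_square_integrable by blast+
  have sqT: "square_integrable \<mu> (gradient \<phi>)"
    using sq(2) square_integrable_distr_iff[OF Tm, of "\<lambda>y. y"] T by simp
  have sp: "square_integrable R p" and sq': "square_integrable R q"
    using sq square_integrable_distr_iff[OF p, of "\<lambda>y. y"] square_integrable_distr_iff[OF q, of "\<lambda>y. y"]
    by (auto simp: pR qR)
  have sTp: "square_integrable R (\<lambda>r. gradient \<phi> (p r))"
    using sqT square_integrable_distr_iff[OF p, of "gradient \<phi>"] by (simp add: pR)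
  have \<phi>p: "integrable R (\<lambda>r. \<phi> (p r))" "(LINT r|R. \<phi> (p r)) = (LINT x|\<mu>. \<phi> x)"
    using integrable_phi[OF \<mu>] unfolding pR[symmetric]
    by (auto simp: integrable_distr_eq integral_distr)
  have \<psi>q: "integrable R (\<lambda>r. \<psi> (q r))" "(LINT r|R. \<psi> (q r)) = (LINT x|\<nu>. \<psi> x)"
    using \<psi>i unfolding qR[symmetric] by (auto simp: integrable_distr_eq integral_distr)
  have pq: "integrable R (\<lambda>r. p r \<bullet> q r)" using square_integrable_inner[OF sp sq'] .
  have "AE r in R. \<forall>z. z \<bullet> q r - \<phi> z \<le> \<psi> (q r)"
    using AE_distrD[OF q] \<psi> unfolding qR[symmetric] by blast
  then have gap: "AE r in R. (norm (gradient \<phi> (p r) - q r))\<^sup>2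
      \<le> 4 * lam * (\<phi> (p r) + \<psi> (q r) - p r \<bullet> q r)"
    by eventually_elim (rule duality_gap_lower)
  have "(l2norm R (\<lambda>r. gradient \<phi> (p r) - q r))\<^sup>2
      \<le> (LINT r|R. 4 * lam * (\<phi> (p r) + \<psi> (q r) - p r \<bullet> q r))"
    unfolding l2norm_power2
    using square_integrable_diff[OF sTp sq'] gap \<phi>p \<psi>q pq
    by (intro integral_mono_AE) (auto simp: square_integrable_def)
  also have "\<dots> = 4 * lam * ((LINT x|\<mu>. x \<bullet> gradient \<phi> x) - (LINT r|R. p r \<bullet> q r))"
    using \<phi>p \<psi>q pq \<psi>I by simp
  also have "\<dots> = 2 * lam * ((l2norm R (\<lambda>r. p r - q r))\<^sup>2 - (l2norm \<mu> (\<lambda>x. x - gradient \<phi> x))\<^sup>2)"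
  proof -
    have "l2norm R p = l2norm \<mu> (\<lambda>x. x)" "l2norm R q = l2norm \<nu> (\<lambda>x. x)"
      "l2norm \<mu> (gradient \<phi>) = l2norm \<nu> (\<lambda>x. x)"
      using l2norm_distr[OF p, of "\<lambda>x. x"] l2norm_distr[OF q, of "\<lambda>x. x"]
        l2norm_distr[OF Tm, of "\<lambda>x. x"] by (auto simp: pR qR T)
    then have "2 * ((LINT x|\<mu>. x \<bullet> gradient \<phi> x) - (LINT r|R. p r \<bullet> q r))
        = (l2norm R (\<lambda>r. p r - q r))\<^sup>2 - (l2norm \<mu> (\<lambda>x. x - gradient \<phi> x))\<^sup>2"
      using l2norm_diff_power2[OF sp sq'] l2norm_diff_power2[OF sq(1) sqT] by simp
    then show ?thesis by simp
  qed
  finally show ?thesis .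
qed

end

section \<open>Gluing of couplings\<close>

lemma sets_borel_prod:
  "sets (borel \<Otimes>\<^sub>M borel) = sets (borel :: ('a::second_countable_topology \<times> 'b::second_countable_topology) measure)"
  by (subst borel_prod) (rule refl)

lemma measurable_fst_borel: "fst \<in> measurable borel borel"
  and measurable_snd_borel: "snd \<in> measurable borel borel"
  by (auto intro!: borel_measurable_continuous_onI continuous_intros)

text \<open>The fibre integrals of \<open>p\<close> are the density of the second marginal with
  respect to itself; uniqueness of densities makes them 1 almost everywhere. Thus \<open>p\<close>
  restricted to a fibre is a conditional probability density.\<close>

lemma coupling_density_marginal:
  fixes P :: "('a::second_countable_topology \<times> 'b::second_countable_topology) measure"
  assumes P: "prob_space P" "sets P = sets borel"
    and A: "A = distr P borel fst" and B: "B = distr P borel snd"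
    and p[measurable]: "p \<in> borel_measurable (A \<Otimes>\<^sub>M B)" and dens: "density (A \<Otimes>\<^sub>M B) p = P"
  shows "AE b in B. (\<integral>\<^sup>+ a. p (a, b) \<partial>A) = 1"
proof -
  interpret P: prob_space P by fact
  have [measurable_cong]: "sets P = sets (borel \<Otimes>\<^sub>M borel)" using P by (simp add: sets_borel_prod)
  have sets[measurable_cong, simp]: "sets A = sets borel" "sets B = sets borel" by (auto simp: A B)
  interpret A: prob_space A unfolding A by (rule P.prob_space_distr) measurable
  interpret B: prob_space B unfolding B by (rule P.prob_space_distr) measurable
  interpret AB: pair_sigma_finite A B ..
  have [measurable]: "(\<lambda>a. p (a, b)) \<in> borel_measurable A" for b
    by (rule measurable_compose[OF measurable_Pair2' p]) (simp add: B)
  have "density B (\<lambda>b. \<integral>\<^sup>+ a. p (a, b) \<partial>A) = B"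
  proof (rule measure_eqI)
    fix F assume "F \<in> sets (density B (\<lambda>b. \<integral>\<^sup>+ a. p (a, b) \<partial>A))"
    then have F[measurable]: "F \<in> sets borel" by simp
    have "emeasure (density B (\<lambda>b. \<integral>\<^sup>+ a. p (a, b) \<partial>A)) F
        = (\<integral>\<^sup>+ b. (\<integral>\<^sup>+ a. p (a, b) * indicator F b \<partial>A) \<partial>B)"
      by (subst emeasure_density) (auto intro!: nn_integral_cong nn_integral_multc[symmetric])
    also have "\<dots> = (\<integral>\<^sup>+ z. p z * indicator (UNIV \<times> F) z \<partial>(A \<Otimes>\<^sub>M B))"
      using AB.nn_integral_snd[of "\<lambda>z. p z * indicator (UNIV \<times> F) z"]
      by (simp add: indicator_times)
    also have "\<dots> = emeasure (density (A \<Otimes>\<^sub>M B) p) (UNIV \<times> F)"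
      by (subst emeasure_density) auto
    also have "\<dots> = emeasure B F"
    proof -
      have "snd -` F \<inter> space P = UNIV \<times> F"
        using sets_eq_imp_space_eq[OF P(2)] by auto
      then have "emeasure B F = emeasure P (UNIV \<times> F)"
        unfolding B by (subst emeasure_distr) auto
      then show ?thesis by (simp only: dens)
    qed
    finally show "emeasure (density B (\<lambda>b. \<integral>\<^sup>+ a. p (a, b) \<partial>A)) F = emeasure B F" .
  qed simp
  then have "density B (\<lambda>b. \<integral>\<^sup>+ a. p (a, b) \<partial>A) = density B (\<lambda>_. 1)"
    by (simp add: density_1)
  then show ?thesis
    by (intro B.density_unique) auto
qed

text \<open>Absolute continuity gives explicit conditional laws of the first coordinate given the
  second. Drawing \<open>c\<close> from \<open>Q\<close> and then the first coordinate from the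
  conditional law at \<open>q c\<close> extends \<open>Q\<close> by a coordinate with the prescribed
  joint law.\<close>

lemma glue_coupling:
  fixes P :: "('a::second_countable_topology \<times> 'b::second_countable_topology) measure"
    and Q :: "'c measure"
  assumes P: "prob_space P" "sets P = sets borel"
    and ac: "absolutely_continuous (distr P borel fst \<Otimes>\<^sub>M distr P borel snd) P"
    and Q: "prob_space Q" and q[measurable]: "q \<in> measurable Q borel"
    and eq: "distr Q borel q = distr P borel snd"
  obtains R where "prob_space R" "sets R = sets (borel \<Otimes>\<^sub>M Q)"
    and "distr R borel (\<lambda>r. (fst r, q (snd r))) = P" "distr R Q snd = Q"
proof -
  interpret P: prob_space P by fact
  interpret Q: prob_space Q by fact
  define A where "A = distr P borel fst"
  define B where "B = distr P borel snd"
  have [measurable_cong]: "sets P = sets (borel \<Otimes>\<^sub>M borel)" using P by (simp add: sets_borel_prod)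
  have sets[measurable_cong, simp]: "sets A = sets borel" "sets B = sets borel" by (auto simp: A_def B_def)
  interpret A: prob_space A unfolding A_def by (rule P.prob_space_distr) measurable
  interpret B: prob_space B unfolding B_def by (rule P.prob_space_distr) measurable
  interpret AB: pair_sigma_finite A B ..
  interpret AQ: pair_sigma_finite A Q ..
  have "sets P = sets (A \<Otimes>\<^sub>M B)"
    using P sets_pair_measure_cong[OF sets] by (simp add: sets_borel_prod)
  then obtain p where p[measurable]: "p \<in> borel_measurable (A \<Otimes>\<^sub>M B)" and dens: "density (A \<Otimes>\<^sub>M B) p = P"
    using AB.Radon_Nikodym[of P] ac by (auto simp: A_def B_def)
  define R where "R = density (A \<Otimes>\<^sub>M Q) (\<lambda>r. p (fst r, q (snd r)))"
  have Tm[measurable]: "(\<lambda>r. (fst r, q (snd r))) \<in> measurable (A \<Otimes>\<^sub>M Q) (A \<Otimes>\<^sub>M B)"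
    by measurable
  have qB: "distr Q B q = B"
    using eq by (simp add: B_def cong: distr_cong)
  \<comment> \<open>The map sends the reference product for \<open>R\<close> to the reference
    product for \<open>P\<close>, so the pulled-back density pushes forward to
    \<open>P\<close>.\<close>
  have "A \<Otimes>\<^sub>M B = distr (A \<Otimes>\<^sub>M Q) (A \<Otimes>\<^sub>M B) (\<lambda>r. (fst r, q (snd r)))"
  proof -
    have "distr A A (\<lambda>x. x) \<Otimes>\<^sub>M distr Q B q = distr (A \<Otimes>\<^sub>M Q) (A \<Otimes>\<^sub>M B) (\<lambda>(x, y). (x, q y))"
      by (rule pair_measure_distr) (auto simp: qB intro: B.sigma_finite_measure_axioms)
    then show ?thesis by (simp add: qB distr_id split_beta')
  qed
  then have PR: "P = distr R (A \<Otimes>\<^sub>M B) (\<lambda>r. (fst r, q (snd r)))"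
    unfolding R_def using dens density_distr[OF p Tm] by simp
  have R1: "distr R borel (\<lambda>r. (fst r, q (snd r))) = P"
  proof -
    have "distr R borel (\<lambda>r. (fst r, q (snd r))) = distr R (A \<Otimes>\<^sub>M B) (\<lambda>r. (fst r, q (snd r)))"
      by (rule distr_cong) (use P \<open>sets P = sets (A \<Otimes>\<^sub>M B)\<close> in auto)
    then show ?thesis using PR by simp
  qed
  have "distr Q borel q = B" using eq by (simp add: B_def)
  then have "AE b in distr Q borel q. (\<integral>\<^sup>+ a. p (a, b) \<partial>A) = 1"
    using coupling_density_marginal[OF P A_def B_def p dens] by (simp only:)
  \<comment> \<open>Normalisation of the fibres, transported along \<open>q\<close>, is what
    preserves \<open>Q\<close> as the second marginal of \<open>R\<close>.\<close>
  then have p1: "AE c in Q. (\<integral>\<^sup>+ a. p (a, q c) \<partial>A) = 1"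
    by (rule AE_distrD[OF q])
  have R2: "distr R Q snd = Q"
  proof (rule measure_eqI)
    fix F assume "F \<in> sets (distr R Q snd)"
    then have F[measurable]: "F \<in> sets Q" by simp
    have "emeasure (distr R Q snd) F = emeasure R (UNIV \<times> F)"
      using sets.sets_into_space[OF F] sets_eq_imp_space_eq[OF sets(1)]
      by (subst emeasure_distr)
        (auto simp: R_def space_pair_measure intro!: arg_cong2[where f = emeasure])
    also have "\<dots> = (\<integral>\<^sup>+ r. p (fst r, q (snd r)) * indicator (UNIV \<times> F) r \<partial>(A \<Otimes>\<^sub>M Q))"
      unfolding R_def by (subst emeasure_density) auto
    also have "\<dots> = (\<integral>\<^sup>+ c. (\<integral>\<^sup>+ a. p (a, q c) * indicator F c \<partial>A) \<partial>Q)"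
      by (subst AQ.nn_integral_snd[symmetric]) (auto simp: indicator_times)
    also have "\<dots> = (\<integral>\<^sup>+ c. indicator F c \<partial>Q)"
    proof (rule nn_integral_cong_AE)
      show "AE c in Q. (\<integral>\<^sup>+ a. p (a, q c) * indicator F c \<partial>A) = indicator F c"
        using p1
      proof eventually_elim
        case (elim c)
        then show ?case by (cases "c \<in> F") auto
      qed
    qed
    finally show "emeasure (distr R Q snd) F = emeasure Q F" by simp
  qed simp
  have sR: "sets R = sets (borel \<Otimes>\<^sub>M Q)"
    unfolding R_def by (simp cong: sets_pair_measure_cong)
  have "prob_space R"
    using prob_space_distrD[of snd R Q] R2 Q by (simp add: R_def)
  with sR R1 R2 that show thesis by blast
qed

section \<open>Plans with an atomic marginal\<close>

lemma absolutely_continuous_countable_marginal: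
  fixes P :: "('a::second_countable_topology \<times> 'b::{second_countable_topology, t1_space}) measure"
  assumes P: "prob_space P" "sets P = sets borel"
    and D: "countable D" "AE b in distr P borel snd. b \<in> D"
  shows "absolutely_continuous (distr P borel fst \<Otimes>\<^sub>M distr P borel snd) P"
proof -
  interpret P: prob_space P by fact
  let ?A = "distr P borel fst" and ?B = "distr P borel snd"
  have [measurable_cong]: "sets P = sets (borel \<Otimes>\<^sub>M borel)" using P by (simp add: sets_borel_prod)
  interpret A: prob_space ?A by (rule P.prob_space_distr) measurable
  interpret B: prob_space ?B by (rule P.prob_space_distr) measurable
  have AED: "AE z in P. snd z \<in> D" using AE_distrD[OF _ D(2)] by simp
  show ?thesis
    unfolding absolutely_continuous_def
  proof
    fix N assume N: "N \<in> null_sets (?A \<Otimes>\<^sub>M ?B)"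
    then have Nm[measurable]: "N \<in> sets (borel \<Otimes>\<^sub>M borel)"
      by (simp add: null_sets_def cong: sets_pair_measure_cong)
    \<comment> \<open>A product null set meets the slice over \<open>d\<close> in a rectangle of
      measure 0, so one of its factors is null for a marginal of \<open>P\<close>. Either case makes
      that part of the slice null for \<open>P\<close>, and countably many slices carry
      \<open>P\<close>.\<close>
    have slice: "AE z in P. \<not> (snd z = d \<and> z \<in> N)" for d
    proof -
      define Nd where "Nd = (\<lambda>a. (a, d)) -` N"
      have Nd[measurable]: "Nd \<in> sets borel"
        using measurable_sets[of "\<lambda>a. (a, d)" borel "borel \<Otimes>\<^sub>M borel" N] Nm by (simp add: Nd_def)
      have "emeasure ?A Nd * emeasure ?B {d} = emeasure (?A \<Otimes>\<^sub>M ?B) (Nd \<times> {d})"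
        by (rule B.emeasure_pair_measure_Times[symmetric]) auto
      also have "\<dots> \<le> emeasure (?A \<Otimes>\<^sub>M ?B) N"
        using N by (intro emeasure_mono) (auto simp: Nd_def)
      finally have "emeasure ?A Nd = 0 \<or> emeasure ?B {d} = 0"
        using N by (simp add: null_sets_def)
      then have "(AE a in ?A. a \<notin> Nd) \<or> (AE b in ?B. b \<notin> {d})"
        using AE_not_in[of Nd ?A] AE_not_in[of "{d}" ?B] by (auto simp: null_sets_def)
      then have "(AE z in P. fst z \<notin> Nd) \<or> (AE z in P. snd z \<notin> {d})"
        using AE_distrD[of fst P borel] AE_distrD[of snd P borel] by auto
      then show ?thesis
        by (auto elim!: eventually_mono simp: Nd_def)
    qed
    then have "AE z in P. \<forall>d\<in>D. \<not> (snd z = d \<and> z \<in> N)"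
      by (subst AE_ball_countable[OF D(1)]) blast
    with AED have "AE z in P. z \<notin> N" by eventually_elim auto
    then show "N \<in> null_sets P"
      using Nm P(2) by (subst AE_iff_null_sets) (auto simp: sets_borel_prod)
  qed
qed

lemma transport_plans_swap:
  assumes "\<pi> \<in> transport_plans \<mu> \<nu>"
  shows "distr \<pi> borel prod.swap \<in> transport_plans \<nu> \<mu>"
proof -
  interpret prob_space \<pi> using assms by (simp add: transport_plans_def)
  have [measurable_cong]: "sets \<pi> = sets (borel \<Otimes>\<^sub>M borel)"
    using assms by (simp add: sets_borel_prod transport_plans_def)
  have [measurable]: "prod.swap \<in> measurable \<pi> (borel \<Otimes>\<^sub>M borel)"
    unfolding prod.swap_def by measurable
  then have sw: "prod.swap \<in> measurable \<pi> borel" by (simp only: borel_prod)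
  have "prob_space (distr \<pi> borel prod.swap)" using sw by (rule prob_space_distr)
  moreover have "distr (distr \<pi> borel prod.swap) borel fst = distr \<pi> borel snd"
    "distr (distr \<pi> borel prod.swap) borel snd = distr \<pi> borel fst"
    using distr_distr[OF measurable_fst_borel sw] distr_distr[OF measurable_snd_borel sw] by (simp_all add: comp_def)
  ultimately show ?thesis using assms by (simp add: transport_plans_def)
qed

lemma absolutely_continuous_countable_marginal_fst:
  fixes P :: "('a::{second_countable_topology, t1_space} \<times> 'b::second_countable_topology) measure"
  assumes P: "prob_space P" "sets P = sets borel"
    and D: "countable D" "AE a in distr P borel fst. a \<in> D"
  shows "absolutely_continuous (distr P borel fst \<Otimes>\<^sub>M distr P borel snd) P"
proof -
  interpret P: prob_space P by fact
  let ?A = "distr P borel fst" and ?B = "distr P borel snd" and ?S = "distr P borel prod.swap"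
  have [measurable_cong]: "sets P = sets (borel \<Otimes>\<^sub>M borel)" using P by (simp add: sets_borel_prod)
  have sw: "prod.swap \<in> measurable P borel"
    unfolding borel_prod[symmetric] prod.swap_def by measurable
  have S: "distr ?S borel fst = ?B" "distr ?S borel snd = ?A"
    using distr_distr[OF measurable_fst_borel sw] distr_distr[OF measurable_snd_borel sw] by (simp_all add: comp_def)
  have ac: "absolutely_continuous (?B \<Otimes>\<^sub>M ?A) ?S"
    using absolutely_continuous_countable_marginal[of ?S D, unfolded S] P.prob_space_distr[OF sw] D
    by simp
  interpret A: prob_space ?A by (rule P.prob_space_distr) measurable
  interpret B: prob_space ?B by (rule P.prob_space_distr) measurable
  interpret pair_sigma_finite ?A ?B ..
  show ?thesis
    unfolding absolutely_continuous_def
  proof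
    fix N assume N: "N \<in> null_sets (?A \<Otimes>\<^sub>M ?B)"
    then have Nm[measurable]: "N \<in> sets (?A \<Otimes>\<^sub>M ?B)" by auto
    have Nb: "N \<in> sets borel" using Nm by (simp add: sets_borel_prod cong: sets_pair_measure_cong)
    have swap: "(\<lambda>(x, y). (y, x)) = (prod.swap :: 'b \<times> 'a \<Rightarrow> _)" by auto
    have "AE z in distr (?B \<Otimes>\<^sub>M ?A) (?A \<Otimes>\<^sub>M ?B) prod.swap. z \<notin> N"
      using AE_not_in[OF N] by (subst (asm) distr_pair_swap) (simp only: swap)
    moreover have swm: "prod.swap \<in> measurable (?B \<Otimes>\<^sub>M ?A) (?A \<Otimes>\<^sub>M ?B)"
      by (simp only: swap[symmetric] measurable_pair_swap')
    ultimately have "AE z in ?B \<Otimes>\<^sub>M ?A. prod.swap z \<notin> N"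
      using AE_distrD[OF swm] by blast
    moreover have "{z. prod.swap z \<in> N} \<in> sets (?B \<Otimes>\<^sub>M ?A)"
      using measurable_sets[OF swm Nm] by (simp add: space_pair_measure vimage_def)
    ultimately have "{z. prod.swap z \<in> N} \<in> null_sets (?B \<Otimes>\<^sub>M ?A)"
      by (subst AE_iff_null_sets) auto
    then have "{z. prod.swap z \<in> N} \<in> null_sets ?S"
      using ac unfolding absolutely_continuous_def by blast
    then have "AE z in ?S. prod.swap z \<notin> N" using AE_not_in by fastforce
    then have "AE z in P. z \<notin> N" using AE_distrD[OF sw] by fastforce
    then show "N \<in> null_sets P"
      using Nb P(2) by (subst AE_iff_null_sets) auto
  qed
qed

section \<open>The quadratic Wasserstein distance\<close>

text \<open>The joint law of \<open>p\<close> and \<open>q\<close> is an admissible plan. All upper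
  bounds on \<open>W2\<close> are obtained by exhibiting suitable random variables on a glued
  space.\<close>

lemma W2_le_l2norm:
  fixes p q :: "'b \<Rightarrow> 'a::euclidean_space"
  assumes "prob_space R" and p: "square_integrable R p" and q: "square_integrable R q"
    and pR: "distr R borel p = \<mu>" and qR: "distr R borel q = \<nu>"
  shows "W2 \<mu> \<nu> \<le> l2norm R (\<lambda>r. p r - q r)"
proof -
  interpret prob_space R by fact
  have [measurable]: "p \<in> borel_measurable R" "q \<in> borel_measurable R"
    using p q by (auto simp: square_integrable_def)
  note [measurable] = measurable_fst_borel measurable_snd_borel
  let ?\<pi> = "distr R borel (\<lambda>r. (p r, q r))"
  have \<pi>: "?\<pi> \<in> transport_plans \<mu> \<nu>"
  proof -
    have "distr ?\<pi> borel fst = distr R borel p" "distr ?\<pi> borel snd = distr R borel q"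
      using distr_distr[OF measurable_fst_borel, of "\<lambda>r. (p r, q r)" R]
        distr_distr[OF measurable_snd_borel, of "\<lambda>r. (p r, q r)" R] by (simp_all add: comp_def)
    moreover have "prob_space ?\<pi>" by (rule prob_space_distr) measurable
    ultimately show ?thesis by (simp add: transport_plans_def pR qR)
  qed
  have int: "integrable R (\<lambda>r. (norm (p r - q r))\<^sup>2)"
    using square_integrable_diff[OF p q] by (simp add: square_integrable_def)
  have "(INF \<gamma>\<in>transport_plans \<mu> \<nu>. \<integral>\<^sup>+ z. ennreal ((norm (fst z - snd z))\<^sup>2) \<partial>\<gamma>)
      \<le> (\<integral>\<^sup>+ z. ennreal ((norm (fst z - snd z))\<^sup>2) \<partial>?\<pi>)"
    using \<pi> by (rule INF_lower)
  also have "\<dots> = (\<integral>\<^sup>+ r. ennreal ((norm (p r - q r))\<^sup>2) \<partial>R)"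
    by (subst nn_integral_distr) auto
  also have "\<dots> = ennreal ((l2norm R (\<lambda>r. p r - q r))\<^sup>2)"
    unfolding l2norm_power2 using int by (intro nn_integral_eq_integral) auto
  finally have "enn2real (INF \<gamma>\<in>transport_plans \<mu> \<nu>. \<integral>\<^sup>+ z. ennreal ((norm (fst z - snd z))\<^sup>2) \<partial>\<gamma>)
      \<le> (l2norm R (\<lambda>r. p r - q r))\<^sup>2"
    by (intro enn2real_leI) auto
  then show ?thesis
    unfolding W2_def by (intro real_le_lsqrt) auto
qed

lemma transport_plan_square_integrable:
  assumes "\<mu> \<in> P2" "\<nu> \<in> P2" "\<pi> \<in> transport_plans \<mu> \<nu>"
  shows "square_integrable \<pi> fst" "square_integrable \<pi> snd"
proof -
  have [measurable_cong]: "sets \<pi> = sets (borel \<Otimes>\<^sub>M borel)"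
    using assms by (simp add: sets_borel_prod transport_plans_def)
  have m: "fst \<in> measurable \<pi> borel" "snd \<in> measurable \<pi> borel" by measurable
  show "square_integrable \<pi> fst" "square_integrable \<pi> snd"
    using P2_square_integrable[OF assms(1)] P2_square_integrable[OF assms(2)] assms(3)
      square_integrable_distr_iff[OF m(1), of "\<lambda>x. x"] square_integrable_distr_iff[OF m(2), of "\<lambda>x. x"]
    by (auto simp: transport_plans_def)
qed

lemma transport_plans_nonempty:
  assumes "prob_space \<mu>" "sets \<mu> = sets borel" "prob_space \<nu>" "sets \<nu> = sets borel"
  shows "transport_plans \<mu> \<nu> \<noteq> {}"
proof -
  interpret M: prob_space \<mu> by fact
  interpret N: prob_space \<nu> by fact
  interpret MN: pair_prob_space \<mu> \<nu> ..
  have "distr (\<mu> \<Otimes>\<^sub>M \<nu>) borel fst = \<mu>"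
    using N.distr_pair_fst[of \<mu>] assms by (simp cong: distr_cong)
  moreover have "distr (\<mu> \<Otimes>\<^sub>M \<nu>) borel snd = \<nu>"
  proof (rule measure_eqI)
    have [measurable_cong]: "sets \<mu> = sets borel" "sets \<nu> = sets borel" using assms by auto
    fix F assume "F \<in> sets (distr (\<mu> \<Otimes>\<^sub>M \<nu>) borel snd)"
    then have F: "F \<in> sets \<nu>" "F \<in> sets borel" using assms by auto
    have "snd -` F \<inter> space (\<mu> \<Otimes>\<^sub>M \<nu>) = space \<mu> \<times> F"
      using sets.sets_into_space[OF F(1)] by (auto simp: space_pair_measure)
    then have "emeasure (distr (\<mu> \<Otimes>\<^sub>M \<nu>) borel snd) F = emeasure (\<mu> \<Otimes>\<^sub>M \<nu>) (space \<mu> \<times> F)"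
      using F by (subst emeasure_distr) auto
    then show "emeasure (distr (\<mu> \<Otimes>\<^sub>M \<nu>) borel snd) F = emeasure \<nu> F"
      using N.emeasure_pair_measure_Times[of "space \<mu>" \<mu> F] F M.emeasure_space_1 by simp
  qed (use assms in simp)
  moreover have "sets (\<mu> \<Otimes>\<^sub>M \<nu>) = sets borel"
    using sets_pair_measure_cong[OF assms(2,4)] by (simp add: sets_borel_prod)
  ultimately have "\<mu> \<Otimes>\<^sub>M \<nu> \<in> transport_plans \<mu> \<nu>"
    using MN.prob_space_axioms by (simp add: transport_plans_def)
  then show ?thesis by blast
qed

text \<open>The strict inequality leaves room to choose a plan from the infimum alone, without a
  minimiser.\<close>

lemma near_optimal_plan:
  assumes \<mu>: "\<mu> \<in> P2" and \<nu>: "\<nu> \<in> P2" and c: "W2 \<mu> \<nu> < c"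
  obtains \<pi> where "\<pi> \<in> transport_plans \<mu> \<nu>" "l2norm \<pi> (\<lambda>z. fst z - snd z) < c"
proof -
  let ?F = "\<lambda>\<pi>. \<integral>\<^sup>+ z. ennreal ((norm (fst z - snd z))\<^sup>2) \<partial>\<pi>"
  let ?I = "INF \<pi>\<in>transport_plans \<mu> \<nu>. ?F \<pi>"
  have F: "?F \<pi> = ennreal ((l2norm \<pi> (\<lambda>z. fst z - snd z))\<^sup>2)" if "\<pi> \<in> transport_plans \<mu> \<nu>" for \<pi>
    unfolding l2norm_power2
    using square_integrable_diff[OF transport_plan_square_integrable[OF \<mu> \<nu> that]]
    by (intro nn_integral_eq_integral) (auto simp: square_integrable_def)
  obtain \<pi>0 where "\<pi>0 \<in> transport_plans \<mu> \<nu>"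
    using transport_plans_nonempty[of \<mu> \<nu>] \<mu> \<nu> by (auto simp: P2_def)
  then have "?I \<le> ?F \<pi>0" by (rule INF_lower)
  also have "\<dots> < \<infinity>" using F[OF \<open>\<pi>0 \<in> _\<close>] by simp
  \<comment> \<open>Finiteness makes \<open>enn2real\<close> faithful here; an infinite infimum
    would have been read as distance 0.\<close>
  finally have fin: "?I < \<infinity>" .
  have "0 \<le> W2 \<mu> \<nu>" by (simp add: W2_def)
  with c have c0: "c > 0" by linarith
  have "enn2real ?I < c\<^sup>2"
    using c c0 unfolding W2_def by (metis real_sqrt_less_iff real_sqrt_unique less_eq_real_def)
  then have "?I < ennreal (c\<^sup>2)"
    using fin by (simp add: enn2real_less_iff c0)
  then obtain \<pi> where \<pi>: "\<pi> \<in> transport_plans \<mu> \<nu>" "?F \<pi> < ennreal (c\<^sup>2)"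
    by (auto simp: INF_less_iff)
  then have "(l2norm \<pi> (\<lambda>z. fst z - snd z))\<^sup>2 < c\<^sup>2"
    using F c0 by (simp add: ennreal_less_iff)
  then have "l2norm \<pi> (\<lambda>z. fst z - snd z) < c"
    using c0 by (meson less_eq_real_def power_less_imp_less_base)
  with \<pi> that show ?thesis by blast
qed

section \<open>Discrete measures\<close>

lemma discrete_measure_sets [simp]: "sets (discrete_measure I w x) = sets borel"
  by (simp add: discrete_measure_def)

lemma
  fixes F :: "'a::euclidean_space \<Rightarrow> 'b::{banach, second_countable_topology}"
  assumes I: "finite I" and F: "F \<in> borel_measurable borel"
  shows integrable_discrete_measure: "integrable (discrete_measure I w x) F"
    and integral_discrete_measure: "(\<And>i. i \<in> I \<Longrightarrow> 0 \<le> w i) \<Longrightarrow>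
      (LINT z|discrete_measure I w x. F z) = (\<Sum>i\<in>I. w i *\<^sub>R F (x i))"
proof -
  have m: "x \<in> measurable (point_measure I (\<lambda>i. ennreal (w i))) borel"
    by (simp add: measurable_point_measure_eq1)
  show "integrable (discrete_measure I w x) F"
    unfolding discrete_measure_def
    using integrable_distr_eq[OF m F] integrable_point_measure_finite[OF I] by blast
  show "(LINT z|discrete_measure I w x. F z) = (\<Sum>i\<in>I. w i *\<^sub>R F (x i))"
    if "\<And>i. i \<in> I \<Longrightarrow> 0 \<le> w i"
    unfolding discrete_measure_def
    using integral_distr[OF m F] lebesgue_integral_point_measure_finite[OF I, of w] that by simp
qed

lemma discrete_measure_P2:
  assumes "finite I" "prob_space (discrete_measure I w x)"
  shows "discrete_measure I w x \<in> P2"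
  using assms by (simp add: P2_def integrable_discrete_measure)

lemma AE_discrete_measure:
  assumes "finite I"
  shows "AE z in discrete_measure I w x. z \<in> x ` I"
proof -
  have m: "x \<in> measurable (point_measure I (\<lambda>i. ennreal (w i))) borel"
    by (simp add: measurable_point_measure_eq1)
  have "{z. z \<in> x ` I} \<in> sets borel" using assms by (intro borel_closed) (simp add: finite_imp_closed)
  then show ?thesis
    unfolding discrete_measure_def by (subst AE_distr_iff[OF m]) (auto simp: AE_point_measure)
qed

lemma l2norm_discrete_measure:
  assumes "finite I" "\<And>i. i \<in> I \<Longrightarrow> 0 \<le> w i" "F \<in> borel_measurable borel"
  shows "l2norm (discrete_measure I w x) F = sqrt (\<Sum>i\<in>I. w i * (norm (F (x i)))\<^sup>2)"
  using assms by (simp add: l2norm_def integral_discrete_measure)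

text \<open>Membership in the set of plans is an equality of measures; testing it with the indicator
  of a single node recovers the weights. Distinctness of the nodes ensures that the test isolates
  one row.\<close>

lemma discrete_plan_row_sum:
  fixes x :: "'i \<Rightarrow> 'a::euclidean_space" and y :: "'j \<Rightarrow> 'b::euclidean_space"
  assumes I: "finite I" and J: "finite J" and x: "inj_on x I" and i: "i \<in> I"
    and f: "\<And>i. i \<in> I \<Longrightarrow> 0 \<le> f i" and w: "\<And>i j. i \<in> I \<Longrightarrow> j \<in> J \<Longrightarrow> 0 \<le> w i j"
    and marg: "distr (discrete_measure (I \<times> J) (\<lambda>(i, j). w i j) (\<lambda>(i, j). (x i, y j))) borel fst
      = discrete_measure I f x"
  shows "(\<Sum>j\<in>J. w i j) = f i"
proof -
  note [measurable] = measurable_fst_borel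
  let ?\<gamma> = "discrete_measure (I \<times> J) (\<lambda>(i, j). w i j) (\<lambda>(i, j). (x i, y j))"
  let ?F = "\<lambda>a. indicator {x i} a :: real"
  have ind: "?F (x k) = (if k = i then 1 else 0)" if "k \<in> I" for k
    using that i x by (auto simp: inj_on_def indicator_def)
  have m: "fst \<in> measurable ?\<gamma> borel"
    using measurable_fst_borel by (simp cong: measurable_cong_sets)
  have "(\<Sum>j\<in>J. w i j) = (\<Sum>k\<in>I. if k = i then \<Sum>j\<in>J. w k j else 0)"
    using I i by simp
  also have "\<dots> = (\<Sum>k\<in>I. \<Sum>j\<in>J. w k j * ?F (x k))"
    using ind by (intro sum.cong) auto
  also have "\<dots> = (\<Sum>p\<in>I \<times> J. (case p of (k, j) \<Rightarrow> w k j) *\<^sub>R ?F (fst (case p of (k, j) \<Rightarrow> (x k, y j))))"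
    by (simp add: sum.cartesian_product split_beta')
  also have "\<dots> = (LINT z|?\<gamma>. ?F (fst z))"
    using I J w by (intro integral_discrete_measure[symmetric]) auto
  also have "\<dots> = (LINT a|discrete_measure I f x. ?F a)"
    unfolding marg[symmetric] by (rule integral_distr[OF m, symmetric]) simp
  also have "\<dots> = (\<Sum>k\<in>I. f k *\<^sub>R ?F (x k))"
    using I f by (intro integral_discrete_measure) auto
  also have "\<dots> = (\<Sum>k\<in>I. if k = i then f k else 0)"
    using ind by (intro sum.cong) auto
  also have "\<dots> = f i" using I i by simp
  finally show ?thesis .
qed

text \<open>Jensen's inequality for the squared norm: expanding around the barycentre
  \<open>m\<close>, the cross terms cancel and the variance term is dropped.\<close>

lemma weighted_mean_deviation_le:
  fixes y :: "'j \<Rightarrow> 'a::real_inner"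
  assumes w: "\<And>j. j \<in> J \<Longrightarrow> 0 \<le> w j" and f: "(\<Sum>j\<in>J. w j) = f" "f > 0"
  shows "f * (norm (t - (1 / f) *\<^sub>R (\<Sum>j\<in>J. w j *\<^sub>R y j)))\<^sup>2 \<le> (\<Sum>j\<in>J. w j * (norm (t - y j))\<^sup>2)"
proof -
  define m where "m = (1 / f) *\<^sub>R (\<Sum>j\<in>J. w j *\<^sub>R y j)"
  have fm: "(\<Sum>j\<in>J. w j *\<^sub>R y j) = f *\<^sub>R m" using f by (simp add: m_def)
  have *: "(norm (t - m))\<^sup>2 + 2 * ((t - m) \<bullet> (m - a)) \<le> (norm (t - a))\<^sup>2" for a
  proof -
    have "(norm (t - a))\<^sup>2 = (norm ((t - m) + (m - a)))\<^sup>2" by simp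
    also have "\<dots> = (norm (t - m))\<^sup>2 + 2 * ((t - m) \<bullet> (m - a)) + (norm (m - a))\<^sup>2"
      by (simp only: power2_norm_eq_inner inner_add_left inner_add_right) (simp add: inner_commute)
    finally show ?thesis by simp
  qed
  have "(\<Sum>j\<in>J. w j * (2 * ((t - m) \<bullet> (m - y j)))) = 2 * ((t - m) \<bullet> (\<Sum>j\<in>J. w j *\<^sub>R (m - y j)))"
    by (simp add: inner_sum_right sum_distrib_left algebra_simps)
  also have "(\<Sum>j\<in>J. w j *\<^sub>R (m - y j)) = 0"
    using f by (simp add: scaleR_diff_right sum_subtractf fm flip: scaleR_sum_left)
  finally have "f * (norm (t - m))\<^sup>2 = (\<Sum>j\<in>J. w j * ((norm (t - m))\<^sup>2 + 2 * ((t - m) \<bullet> (m - y j))))"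
    using f by (simp add: distrib_left sum.distrib flip: sum_distrib_right)
  also have "\<dots> \<le> (\<Sum>j\<in>J. w j * (norm (t - y j))\<^sup>2)"
    using w * by (intro sum_mono mult_left_mono)
  finally show ?thesis unfolding m_def .
qed

section \<open>Stability of transport plans\<close>

lemma transport_plan_absolutely_continuous:
  assumes "\<pi> \<in> transport_plans \<mu> \<nu>" "countable D" "AE b in \<nu>. b \<in> D"
  shows "absolutely_continuous (distr \<pi> borel fst \<Otimes>\<^sub>M distr \<pi> borel snd) \<pi>"
  using assms by (intro absolutely_continuous_countable_marginal[of \<pi> D]) (auto simp: transport_plans_def)

lemma transport_plan_absolutely_continuous_fst:
  assumes "\<pi> \<in> transport_plans \<mu> \<nu>" "countable D" "AE b in \<mu>. b \<in> D"
  shows "absolutely_continuous (distr \<pi> borel fst \<Otimes>\<^sub>M distr \<pi> borel snd) \<pi>"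
  using assms by (intro absolutely_continuous_countable_marginal_fst[of \<pi> D]) (auto simp: transport_plans_def)

text \<open>Gluing \<alpha> and \<beta> along \<nu> produces a chain \<open>x'\<close>,
  \<open>x\<close>, \<open>T x\<close>, \<open>y'\<close> whose ends couple \<open>\<mu>'\<close>
  with \<open>\<nu>'\<close>; Minkowski's inequality bounds its length.\<close>

lemma W2_triangle_through_map:
  fixes \<mu> :: "'a::euclidean_space measure" and \<nu> :: "'a measure"
  assumes P2: "\<mu> \<in> P2" "\<nu> \<in> P2" "\<mu>' \<in> P2" "\<nu>' \<in> P2"
    and T[measurable]: "T \<in> borel_measurable borel" and \<nu>: "distr \<mu> borel T = \<nu>"
    and \<alpha>: "\<alpha> \<in> transport_plans \<mu> \<mu>'" and \<beta>: "\<beta> \<in> transport_plans \<nu> \<nu>'"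
    and D: "countable D" "AE y in \<nu>'. y \<in> D"
  shows "W2 \<mu>' \<nu>' \<le> l2norm \<alpha> (\<lambda>z. fst z - snd z) + l2norm \<mu> (\<lambda>x. x - T x)
    + l2norm \<beta> (\<lambda>z. fst z - snd z)"
proof -
  note [measurable] = measurable_fst_borel measurable_snd_borel
  let ?\<beta> = "distr \<beta> borel prod.swap"
  \<comment> \<open>Gluing takes place along the second coordinate, so the swap moves \<nu> there;
    the atomic \<open>\<nu>'\<close> becomes the first marginal.\<close>
  have \<beta>': "?\<beta> \<in> transport_plans \<nu>' \<nu>" using \<beta> by (rule transport_plans_swap)
  have s\<alpha>[measurable_cong]: "sets \<alpha> = sets borel" using \<alpha> by (simp add: transport_plans_def)
  have s\<beta>[measurable_cong]: "sets \<beta> = sets borel" using \<beta> by (simp add: transport_plans_def)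
  have s\<mu>[measurable_cong]: "sets \<mu> = sets borel" using P2 by (simp add: P2_def)
  have q[measurable]: "(\<lambda>z. T (fst z)) \<in> measurable \<alpha> borel" by measurable
  have "distr \<alpha> borel (\<lambda>z. T (fst z)) = distr ?\<beta> borel snd"
    using distr_distr[of T borel borel fst \<alpha>] \<alpha> \<beta>' \<nu>
    by (simp add: transport_plans_def comp_def)
  then obtain R where R: "prob_space R" and sR: "sets R = sets (borel \<Otimes>\<^sub>M \<alpha>)"
    and R\<beta>: "distr R borel (\<lambda>r. (fst r, T (fst (snd r)))) = ?\<beta>" and R\<alpha>: "distr R \<alpha> snd = \<alpha>"
    using glue_coupling[of ?\<beta> \<alpha> "\<lambda>z. T (fst z)"]
      transport_plan_absolutely_continuous_fst[OF \<beta>' D] \<beta>' \<alpha>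
    by (auto simp: transport_plans_def)
  note [measurable_cong] = sR
  define x where "x r = fst (snd r)" for r :: "'a \<times> 'a \<times> 'a"
  define x' where "x' r = snd (snd r)" for r :: "'a \<times> 'a \<times> 'a"
  define y' where "y' r = fst r" for r :: "'a \<times> 'a \<times> 'a"
  have [measurable]: "x \<in> measurable R borel" "x' \<in> measurable R borel" "y' \<in> measurable R borel"
    unfolding x_def[abs_def] x'_def[abs_def] y'_def[abs_def] by measurable
  have Rx: "distr R borel (\<lambda>r. (x r, x' r)) = \<alpha>"
    using R\<alpha> s\<alpha> by (simp add: x_def x'_def cong: distr_cong)
  have Ry: "distr R borel (\<lambda>r. (T (x r), y' r)) = \<beta>"
  proof -
    have sw: "prod.swap \<in> measurable borel (borel :: ('a \<times> 'a) measure)"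
      "prod.swap \<in> measurable \<beta> (borel :: ('a \<times> 'a) measure)"
      unfolding prod.swap_def borel_prod[symmetric] by measurable
    have "distr R borel (\<lambda>r. (T (x r), y' r)) = distr (distr R borel (\<lambda>r. (y' r, T (x r)))) borel prod.swap"
      by (subst distr_distr[OF sw(1)]) (auto simp: comp_def)
    also have "\<dots> = distr ?\<beta> borel prod.swap" using R\<beta> by (simp add: x_def y'_def)
    also have "\<dots> = \<beta>"
      using distr_distr[OF sw] s\<beta> by (simp add: comp_def distr_id2)
    finally show ?thesis .
  qed
  have marg: "distr R borel x = \<mu>" "distr R borel x' = \<mu>'" "distr R borel y' = \<nu>'"
    using distr_distr[OF measurable_fst_borel, of "\<lambda>r. (x r, x' r)" R]
      distr_distr[OF measurable_snd_borel, of "\<lambda>r. (x r, x' r)" R]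
      distr_distr[OF measurable_snd_borel, of "\<lambda>r. (T (x r), y' r)" R] \<alpha> \<beta>
    by (simp_all add: Rx Ry comp_def transport_plans_def)
  have sq: "square_integrable R x" "square_integrable R x'" "square_integrable R y'"
    using P2 marg by (auto intro!: square_integrable_of_marginal)
  have "square_integrable \<mu> T"
    using \<nu> P2(2) by (intro square_integrable_of_marginal) auto
  then have sqT: "square_integrable R (\<lambda>r. T (x r))"
    using square_integrable_distr_iff[of x R T] by (simp only: marg) simp
  have "W2 \<mu>' \<nu>' \<le> l2norm R (\<lambda>r. x' r - y' r)"
    using W2_le_l2norm[OF R sq(2,3) marg(2,3)] .
  also have "\<dots> \<le> l2norm R (\<lambda>r. x' r - x r) + l2norm R (\<lambda>r. x r - T (x r)) + l2norm R (\<lambda>r. T (x r) - y' r)"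
    using l2norm_diff_le[OF sq(2,1,3)] l2norm_diff_le[OF sq(1) sqT sq(3)] by simp
  also have "l2norm R (\<lambda>r. x' r - x r) = l2norm \<alpha> (\<lambda>z. fst z - snd z)"
    unfolding Rx[symmetric] by (subst l2norm_distr) (auto intro: l2norm_minus_commute)
  also have "l2norm R (\<lambda>r. x r - T (x r)) = l2norm \<mu> (\<lambda>x. x - T x)"
    unfolding marg(1)[symmetric] by (subst l2norm_distr) auto
  also have "l2norm R (\<lambda>r. T (x r) - y' r) = l2norm \<beta> (\<lambda>z. fst z - snd z)"
    unfolding Ry[symmetric] by (subst l2norm_distr) auto
  finally show ?thesis .
qed

text \<open>Two successive gluings: \<alpha> onto \<gamma> along \<open>\<mu>'\<close>, then \<beta>
  onto the result along \<open>\<nu>'\<close>. In each the common marginal is atomic, which supplies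
  the conditional laws.\<close>

lemma glue_three_plans:
  fixes \<mu> \<nu> \<mu>' \<nu>' :: "'a::euclidean_space measure"
  assumes \<alpha>: "\<alpha> \<in> transport_plans \<mu> \<mu>'" and \<gamma>: "\<gamma> \<in> transport_plans \<mu>' \<nu>'"
    and \<beta>: "\<beta> \<in> transport_plans \<nu> \<nu>'"
    and D: "countable D" "AE y in \<mu>'. y \<in> D" and E: "countable E" "AE y in \<nu>'. y \<in> E"
  obtains R :: "('a \<times> 'a \<times> 'a \<times> 'a) measure" and x x' y' y where "prob_space R"
    "x \<in> borel_measurable R" "x' \<in> borel_measurable R" "y' \<in> borel_measurable R" "y \<in> borel_measurable R"
    "distr R borel (\<lambda>r. (x r, x' r)) = \<alpha>" "distr R borel (\<lambda>r. (x' r, y' r)) = \<gamma>"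
    "distr R borel (\<lambda>r. (y r, y' r)) = \<beta>"
proof -
  note [measurable] = measurable_fst_borel measurable_snd_borel
  have s[measurable_cong]: "sets \<alpha> = sets borel" "sets \<beta> = sets borel" "sets \<gamma> = sets borel"
    using \<alpha> \<beta> \<gamma> by (auto simp: transport_plans_def)
  have "distr \<gamma> borel fst = distr \<alpha> borel snd" using \<alpha> \<gamma> by (simp add: transport_plans_def)
  moreover have "fst \<in> measurable \<gamma> borel" by measurable
  ultimately obtain S where S: "prob_space S" and sS: "sets S = sets (borel \<Otimes>\<^sub>M \<gamma>)"
    and S\<alpha>: "distr S borel (\<lambda>r. (fst r, fst (snd r))) = \<alpha>" and S\<gamma>: "distr S \<gamma> snd = \<gamma>"
    using glue_coupling[of \<alpha> \<gamma> fst] transport_plan_absolutely_continuous[OF \<alpha> D] \<alpha> \<gamma>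
    by (auto simp: transport_plans_def)
  note [measurable_cong] = sS
  have mS[measurable]: "snd \<in> measurable S \<gamma>" "snd \<in> measurable S borel" by measurable
  have q: "(\<lambda>r. snd (snd r)) \<in> measurable S borel" by measurable
  have "distr S borel (\<lambda>r. snd (snd r)) = distr (distr S \<gamma> snd) borel snd"
    by (subst distr_distr) (auto simp: comp_def)
  also have "\<dots> = distr \<beta> borel snd" using \<beta> \<gamma> S\<gamma> by (simp add: transport_plans_def)
  finally obtain R where R: "prob_space R" and sR: "sets R = sets (borel \<Otimes>\<^sub>M S)"
    and R\<beta>: "distr R borel (\<lambda>r. (fst r, snd (snd (snd r)))) = \<beta>" and RS: "distr R S snd = S"
    using glue_coupling[of \<beta> S "\<lambda>r. snd (snd r)"] transport_plan_absolutely_continuous[OF \<beta> E] \<beta> S q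
    by (auto simp: transport_plans_def)
  note [measurable_cong] = sR
  have mR[measurable]: "snd \<in> measurable R S" by measurable
  have "distr R borel (\<lambda>r. (fst (snd r), fst (snd (snd r)))) = distr (distr R S snd) borel (\<lambda>r. (fst r, fst (snd r)))"
    by (subst distr_distr) (auto simp: comp_def)
  also have "\<dots> = \<alpha>" by (simp only: RS S\<alpha>)
  finally have R\<alpha>: "distr R borel (\<lambda>r. (fst (snd r), fst (snd (snd r)))) = \<alpha>" .
  have "distr R borel (\<lambda>r. (fst (snd (snd r)), snd (snd (snd r)))) = distr (distr R S snd) borel snd"
    by (subst distr_distr) (auto simp: comp_def)
  also have "\<dots> = \<gamma>" using S\<gamma> s by (simp add: RS cong: distr_cong)
  finally have R\<gamma>: "distr R borel (\<lambda>r. (fst (snd (snd r)), snd (snd (snd r)))) = \<gamma>" .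
  show thesis
    by (rule that[OF R _ _ _ _ R\<alpha> R\<gamma> R\<beta>]) measurable
qed

text \<open>The constant \<open>C\<close> is explicit in the second moments of \<mu> and \<nu> and
  in \<open>C1\<close> and \<open>C2\<close>, so one choice serves all \<open>lam\<close>, \<phi>
  and \<open>h\<close>. Discreteness enters through the countable carriers \<open>D\<close> and
  \<open>E\<close>, which make the gluing possible.\<close>

lemma (in smooth_convex) plan_stability:
  assumes P2: "\<mu> \<in> P2" "\<nu> \<in> P2" "\<mu>' \<in> P2" "\<nu>' \<in> P2"
    and \<nu>: "distr \<mu> borel (gradient \<phi>) = \<nu>" and \<gamma>: "\<gamma> \<in> transport_plans \<mu>' \<nu>'"
    and D: "countable D" "AE y in \<mu>'. y \<in> D" and E: "countable E" "AE y in \<nu>'. y \<in> E"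
    and C1: "C1 > 0" and C2: "C2 > 0" and h: "0 < h" "h \<le> lam" "h \<le> inverse lam"
    and W: "W2 \<mu> \<mu>' \<le> C1 * h" "W2 \<nu> \<nu>' \<le> C1 * h"
    and opt: "l2norm \<gamma> (\<lambda>z. fst z - snd z) - W2 \<mu>' \<nu>' \<le> C2 * h"
    and c: "c = 8 * C1 + C2"
    and C: "C = 6 * C1 + sqrt (2 * (2 * (l2norm \<mu> (\<lambda>x. x) + l2norm \<nu> (\<lambda>y. y)) * c + c\<^sup>2))"
  shows "l2norm \<gamma> (\<lambda>z. gradient \<phi> (fst z) - snd z) \<le> C * sqrt lam * sqrt h"
    and "W2 (distr \<mu> borel (\<lambda>x. (x, gradient \<phi> x))) \<gamma> \<le> C * sqrt lam * sqrt h"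
proof -
  note [measurable] = measurable_fst_borel measurable_snd_borel
  let ?T = "gradient \<phi>"
  define S where "S = sqrt lam * sqrt h"
  define K where "K = 2 * (l2norm \<mu> (\<lambda>x. x) + l2norm \<nu> (\<lambda>y. y)) * c + c\<^sup>2"
  have c0: "c > 0" using c C1 C2 by simp
  then have K0: "K \<ge> 0" by (simp add: K_def)
  \<comment> \<open>The bound \<open>h \<le> lam\<close> absorbs errors of order \<open>h\<close>;
    below, \<open>lam * h \<le> 1\<close> absorbs errors of order \<open>lam * h\<close>.\<close>
  have hS: "h \<le> S"
  proof -
    have "h = sqrt h * sqrt h" using h by simp
    also have "\<dots> \<le> S" unfolding S_def using h by (intro mult_right_mono) auto
    finally show ?thesis .
  qed
  have lh: "lam * h \<le> 1" using h lam_pos by (simp add: field_simps)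
  have S2: "S = sqrt (lam * h)" by (simp add: S_def real_sqrt_mult)
  have lhS: "lam * h \<le> S"
  proof -
    have "(lam * h)\<^sup>2 \<le> lam * h"
      using lh lam_pos h by (simp add: power2_eq_square mult_left_le)
    then show ?thesis unfolding S2 by (rule real_le_rsqrt)
  qed
  \<comment> \<open>One of \<open>lam\<close> and its inverse is at most 1.\<close>
  have h1: "h \<le> 1"
  proof (cases "lam \<le> 1")
    case False
    then have "inverse lam \<le> 1" by (simp add: inverse_le_1_iff)
    then show ?thesis using h by simp
  qed (use h in simp)
  have s\<mu>[measurable_cong]: "sets \<mu> = sets borel" using P2 by (simp add: P2_def)
  \<comment> \<open>Doubling \<open>C1\<close> creates the strict inequality demanded by
    near-optimal plans.\<close>
  have C1h: "C1 * h < 2 * C1 * h" using C1 h by simp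
  obtain \<alpha> where \<alpha>: "\<alpha> \<in> transport_plans \<mu> \<mu>'" "l2norm \<alpha> (\<lambda>z. fst z - snd z) < 2 * C1 * h"
    using near_optimal_plan[OF P2(1,3), of "2 * C1 * h"] W(1) C1h by (metis le_less_trans)
  obtain \<beta> where \<beta>: "\<beta> \<in> transport_plans \<nu> \<nu>'" "l2norm \<beta> (\<lambda>z. fst z - snd z) < 2 * C1 * h"
    using near_optimal_plan[OF P2(2,4), of "2 * C1 * h"] W(2) C1h by (metis le_less_trans)
  let ?w = "l2norm \<mu> (\<lambda>x. x - ?T x)"
  have W': "W2 \<mu>' \<nu>' \<le> ?w + 4 * C1 * h"
    using W2_triangle_through_map[OF P2 gradient_measurable \<nu> \<alpha>(1) \<beta>(1) E] \<alpha>(2) \<beta>(2) by simp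
  obtain R :: "('a \<times> 'a \<times> 'a \<times> 'a) measure" and x x' y' y where R: "prob_space R"
    and m[measurable]: "x \<in> borel_measurable R" "x' \<in> borel_measurable R" "y' \<in> borel_measurable R" "y \<in> borel_measurable R"
    and R\<alpha>: "distr R borel (\<lambda>r. (x r, x' r)) = \<alpha>" and R\<gamma>: "distr R borel (\<lambda>r. (x' r, y' r)) = \<gamma>"
    and R\<beta>: "distr R borel (\<lambda>r. (y r, y' r)) = \<beta>"
    using glue_three_plans[OF \<alpha>(1) \<gamma> \<beta>(1) D E] .
  have marg: "distr R borel x = \<mu>" "distr R borel x' = \<mu>'" "distr R borel y' = \<nu>'" "distr R borel y = \<nu>"
    using distr_distr[OF measurable_fst_borel, of "\<lambda>r. (x r, x' r)" R]
      distr_distr[OF measurable_snd_borel, of "\<lambda>r. (x r, x' r)" R]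
      distr_distr[OF measurable_fst_borel, of "\<lambda>r. (y r, y' r)" R]
      distr_distr[OF measurable_snd_borel, of "\<lambda>r. (y r, y' r)" R] \<alpha>(1) \<beta>(1)
    by (simp_all add: R\<alpha> R\<beta> comp_def transport_plans_def)
  have sq: "square_integrable R x" "square_integrable R x'" "square_integrable R y'" "square_integrable R y"
    using P2 marg m by (auto intro!: square_integrable_of_marginal)
  have sq\<mu>: "square_integrable \<mu> (\<lambda>x. x)" using P2 P2_square_integrable by blast
  have sqT\<mu>: "square_integrable \<mu> ?T"
    using \<nu> P2(2) by (intro square_integrable_of_marginal) auto
  then have sqT: "square_integrable R (\<lambda>r. ?T (x r))"
    using square_integrable_distr_iff[of x R ?T] by (simp only: marg) simp
  have lip: "norm (?T (x' r) - ?T (x r)) \<le> norm ((2 * lam) *\<^sub>R (x r - x' r))" for r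
    using gradient_lipschitz[of "x' r" "x r"] lam_pos by (simp add: norm_minus_commute)
  \<comment> \<open>The law of \<open>?T (x' r)\<close> is not one of the given measures; its second
    moment comes from the Lipschitz comparison with \<open>?T (x r)\<close>.\<close>
  have sqT': "square_integrable R (\<lambda>r. ?T (x' r))"
  proof -
    have "square_integrable R (\<lambda>r. ?T (x' r) - ?T (x r))"
    proof -
      have "integrable R (\<lambda>r. (norm (?T (x' r) - ?T (x r)))\<^sup>2)"
      proof (rule Bochner_Integration.integrable_bound)
        show "integrable R (\<lambda>r. (norm ((2 * lam) *\<^sub>R (x r - x' r)))\<^sup>2)"
          using square_integrable_scaleR[OF square_integrable_diff[OF sq(1,2)]]
          by (simp only: square_integrable_def)
        show "AE r in R. norm ((norm (?T (x' r) - ?T (x r)))\<^sup>2) \<le> norm ((norm ((2 * lam) *\<^sub>R (x r - x' r)))\<^sup>2)"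
          using lip by (intro AE_I2) (simp only: real_norm_def abs_power2 power_mono norm_ge_zero)
      qed measurable
      then show ?thesis by (simp add: square_integrable_def)
    qed
    from square_integrable_add[OF this sqT] show ?thesis by simp
  qed
  have xx': "l2norm R (\<lambda>r. x r - x' r) \<le> 2 * C1 * h"
    using \<alpha>(2) unfolding R\<alpha>[symmetric] by (subst (asm) l2norm_distr) auto
  have yy': "l2norm R (\<lambda>r. y r - y' r) \<le> 2 * C1 * h"
    using \<beta>(2) unfolding R\<beta>[symmetric] by (subst (asm) l2norm_distr) auto
  have x'y': "l2norm R (\<lambda>r. x' r - y' r) = l2norm \<gamma> (\<lambda>z. fst z - snd z)"
    unfolding R\<gamma>[symmetric] by (subst l2norm_distr) auto
  \<comment> \<open>The \<open>8 * C1\<close> in \<open>c\<close> consists of two errors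
    \<open>2 * C1 * h\<close> in passing from \<open>(x, y)\<close> to \<open>(x', y')\<close> and
    of \<open>4 * C1 * h\<close> from the triangle estimate for \<open>W2\<close>; \<open>C2\<close>
    is the suboptimality of \<gamma>.\<close>
  have D1: "l2norm R (\<lambda>r. x r - y r) \<le> ?w + c * h"
  proof -
    have "l2norm R (\<lambda>r. x r - y r)
        \<le> l2norm R (\<lambda>r. x r - x' r) + l2norm R (\<lambda>r. x' r - y' r) + l2norm R (\<lambda>r. y' r - y r)"
      using l2norm_diff_le[OF sq(1,2,4)] l2norm_diff_le[OF sq(2,3,4)] by simp
    also have "\<dots> \<le> ?w + c * h"
      using xx' yy' opt W' by (simp add: x'y' l2norm_minus_commute[of R y' y] c algebra_simps)
    finally show ?thesis .
  qed
  have w_le: "?w \<le> l2norm \<mu> (\<lambda>x. x) + l2norm \<nu> (\<lambda>y. y)"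
  proof -
    have "?w \<le> l2norm \<mu> (\<lambda>x. x) + l2norm \<mu> (\<lambda>x. - ?T x)"
      using l2norm_add_le[OF sq\<mu> square_integrable_scaleR[OF sqT\<mu>, of "-1"]] by simp
    also have "l2norm \<mu> (\<lambda>x. - ?T x) = l2norm \<nu> (\<lambda>y. y)"
      unfolding \<nu>[symmetric] by (subst l2norm_distr) (auto simp: l2norm_def)
    finally show ?thesis .
  qed
  \<comment> \<open>Squaring turns the excess of order \<open>h\<close> in the norm into one of
    order \<open>h\<close> in the cost: the cross term is bounded by the second moments, and
    \<open>h \<le> 1\<close> handles the quadratic term.\<close>
  have gap: "(l2norm R (\<lambda>r. x r - y r))\<^sup>2 - ?w\<^sup>2 \<le> K * h"
  proof -
    have "(l2norm R (\<lambda>r. x r - y r))\<^sup>2 \<le> (?w + c * h)\<^sup>2"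
      using D1 by (rule power_mono) simp
    also have "\<dots> = ?w\<^sup>2 + (2 * ?w * c + c\<^sup>2 * h) * h"
      by (simp add: power2_eq_square algebra_simps)
    also have "\<dots> \<le> ?w\<^sup>2 + K * h"
    proof -
      have "?w * c \<le> (l2norm \<mu> (\<lambda>x. x) + l2norm \<nu> (\<lambda>y. y)) * c"
        using w_le c0 by (intro mult_right_mono) auto
      moreover have "c\<^sup>2 * h \<le> c\<^sup>2" using h1 h by (simp add: mult_left_le)
      ultimately have "2 * ?w * c + c\<^sup>2 * h \<le> K" unfolding K_def by linarith
      then show ?thesis using h by (intro add_left_mono mult_right_mono) auto
    qed
    finally show ?thesis by simp
  qed
  have Txy: "l2norm R (\<lambda>r. ?T (x r) - y r) \<le> sqrt (2 * K) * S"
  proof -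
    have "(l2norm R (\<lambda>r. ?T (x r) - y r))\<^sup>2 \<le> 2 * lam * (K * h)"
      using l2norm_gradient_minus_plan[OF P2(1,2) \<nu> m(1,4) marg(1,4)] gap lam_pos
      by (meson mult_left_mono mult_pos_pos less_eq_real_def order_trans zero_less_numeral)
    then have "l2norm R (\<lambda>r. ?T (x r) - y r) \<le> sqrt (2 * lam * (K * h))"
      by (rule real_le_rsqrt)
    also have "2 * lam * (K * h) = 2 * K * (lam * h)" by simp
    also have "sqrt \<dots> = sqrt (2 * K) * S" by (simp only: real_sqrt_mult S_def)
    finally show ?thesis .
  qed
  have Txy': "l2norm R (\<lambda>r. ?T (x r) - y' r) \<le> sqrt (2 * K) * S + 2 * C1 * h"
    using l2norm_diff_le[OF sqT sq(4,3)] Txy yy' by simp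
  have TT: "l2norm R (\<lambda>r. ?T (x' r) - ?T (x r)) \<le> 4 * C1 * (lam * h)"
  proof -
    have "l2norm R (\<lambda>r. ?T (x' r) - ?T (x r)) \<le> l2norm R (\<lambda>r. (2 * lam) *\<^sub>R (x r - x' r))"
      using square_integrable_diff[OF sqT' sqT] square_integrable_scaleR[OF square_integrable_diff[OF sq(1,2)]] lip
      by (rule l2norm_mono)
    also have "\<dots> = 2 * lam * l2norm R (\<lambda>r. x r - x' r)"
      using lam_pos by (subst l2norm_scaleR) simp
    also have "\<dots> \<le> 2 * lam * (2 * C1 * h)" using xx' lam_pos by simp
    finally show ?thesis by (simp only: mult_ac)
  qed
  \<comment> \<open>The duality gap contributes \<open>sqrt (2 * K)\<close>. In the first claim
    \<open>6 * C1\<close> is \<open>4 * C1\<close> from the Lipschitz step plus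
    \<open>2 * C1\<close> from replacing \<open>y\<close> by \<open>y'\<close>; the second claim
    uses up only \<open>4 * C1\<close>.\<close>
  have CS: "C * sqrt lam * sqrt h = 6 * C1 * S + sqrt (2 * K) * S"
    by (simp add: C K_def S_def algebra_simps)
  have bounds: "C1 * h \<le> C1 * S" "C1 * (lam * h) \<le> C1 * S"
    using hS lhS C1 by simp_all
  have S0: "C1 * S \<ge> 0" using C1 lam_pos h by (simp add: S_def)
  have "l2norm \<gamma> (\<lambda>z. ?T (fst z) - snd z) = l2norm R (\<lambda>r. ?T (x' r) - y' r)"
    unfolding R\<gamma>[symmetric] by (subst l2norm_distr) auto
  also have "\<dots> \<le> C * sqrt lam * sqrt h"
    using l2norm_diff_le[OF sqT' sqT sq(3)] TT Txy' bounds S0 unfolding CS by linarith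
  finally show "l2norm \<gamma> (\<lambda>z. ?T (fst z) - snd z) \<le> C * sqrt lam * sqrt h" .
  have "W2 (distr \<mu> borel (\<lambda>x. (x, ?T x))) \<gamma> \<le> l2norm R (\<lambda>r. (x r, ?T (x r)) - (x' r, y' r))"
  proof (rule W2_le_l2norm[OF R _ _ _ R\<gamma>])
    show "square_integrable R (\<lambda>r. (x r, ?T (x r)))" "square_integrable R (\<lambda>r. (x' r, y' r))"
      using sq sqT by (auto intro: square_integrable_Pair)
    show "distr R borel (\<lambda>r. (x r, ?T (x r))) = distr \<mu> borel (\<lambda>x. (x, ?T x))"
      unfolding marg(1)[symmetric] by (subst distr_distr) (auto simp: comp_def)
  qed
  also have "\<dots> = l2norm R (\<lambda>r. (x r - x' r, ?T (x r) - y' r))" by simp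
  also have "\<dots> \<le> l2norm R (\<lambda>r. x r - x' r) + l2norm R (\<lambda>r. ?T (x r) - y' r)"
    by (rule l2norm_Pair_le[OF square_integrable_diff[OF sq(1,2)] square_integrable_diff[OF sqT sq(3)]])
  also have "\<dots> \<le> C * sqrt lam * sqrt h"
    using xx' Txy' bounds S0 unfolding CS by linarith
  finally show "W2 (distr \<mu> borel (\<lambda>x. (x, ?T x))) \<gamma> \<le> C * sqrt lam * sqrt h" .
qed

section \<open>Application to discrete plans and their barycentric projections\<close>

theorem theorem5p1:
  fixes \<mu> \<nu> :: "(real ^ 'd) measure"
    and f g :: "real ^ 'd \<Rightarrow> real"
    and C1 C2 :: real
  assumes "\<mu> \<in> P2" and "\<nu> \<in> P2"
    and "f \<in> borel_measurable borel" and "\<forall>x. f x \<ge> 0"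
    and "\<mu> = density lborel (\<lambda>x. ennreal (f x))"
    and "g \<in> borel_measurable borel" and "\<forall>y. g y \<ge> 0"
    and "\<nu> = density lborel (\<lambda>y. ennreal (g y))"
    and "C1 > 0" and "C2 > 0"
  shows "\<exists>C::real.
    \<forall>(lam::real) (\<phi> :: real ^ 'd \<Rightarrow> real) (X :: (real ^ 'd) set) (Y :: (real ^ 'd) set).
      lam > 0 \<and> lambda_regular lam \<mu> \<nu> \<phi> \<and>
      X \<in> sets borel \<and> emeasure \<mu> (- X) = 0 \<and>
      Y \<in> sets borel \<and> emeasure \<nu> (- Y) = 0 \<longrightarrow>
      (let T = gradient \<phi>; \<gamma> = distr \<mu> borel (\<lambda>x. (x, T x)) in
       \<forall>(h::real) (N::nat) (M::nat)
         (x :: nat \<Rightarrow> real ^ 'd) (y :: nat \<Rightarrow> real ^ 'd)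
         (fh :: nat \<Rightarrow> real) (gh :: nat \<Rightarrow> real) (w :: nat \<Rightarrow> nat \<Rightarrow> real).
         let \<mu>h = discrete_measure {1..N} fh x;
             \<nu>h = discrete_measure {1..M} gh y;
             \<gamma>h = discrete_measure ({1..N} \<times> {1..M}) (\<lambda>(i, j). w i j) (\<lambda>(i, j). (x i, y j))
         in
           0 < h \<and> h \<le> min lam (inverse lam) \<and>
           inj_on x {1..N} \<and> (\<forall>i\<in>{1..N}. x i \<in> X) \<and>
           inj_on y {1..M} \<and> (\<forall>j\<in>{1..M}. y j \<in> Y) \<and>
           (\<forall>i\<in>{1..N}. fh i > 0) \<and> (\<forall>j\<in>{1..M}. gh j > 0) \<and>
           prob_space \<mu>h \<and> prob_space \<nu>h \<and>
           W2 \<mu> \<mu>h \<le> C1 * h \<and> W2 \<nu> \<nu>h \<le> C1 * h \<and>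
           (\<forall>i\<in>{1..N}. \<forall>j\<in>{1..M}. w i j \<ge> 0) \<and>
           \<gamma>h \<in> transport_plans \<mu>h \<nu>h \<and>
           sqrt (\<Sum>i=1..N. \<Sum>j=1..M. w i j * (norm (x i - y j))\<^sup>2) - W2 \<mu>h \<nu>h \<le> C2 * h
           \<longrightarrow>
           sqrt (LINT z:X \<times> Y|\<gamma>h. (norm (T (fst z) - snd z))\<^sup>2)
             = sqrt (\<Sum>i=1..N. \<Sum>j=1..M. w i j * (norm (T (x i) - y j))\<^sup>2) \<and>
           sqrt (\<Sum>i=1..N. \<Sum>j=1..M. w i j * (norm (T (x i) - y j))\<^sup>2)
             \<le> C * sqrt lam * sqrt h \<and>
           W2 \<gamma> \<gamma>h \<le> C * sqrt lam * sqrt h \<and>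
           (\<forall>Th :: real ^ 'd \<Rightarrow> real ^ 'd.
             (\<forall>i\<in>{1..N}. Th (x i) = (1 / fh i) *\<^sub>R (\<Sum>j=1..M. w i j *\<^sub>R y j)) \<longrightarrow>
             sqrt (\<Sum>i=1..N. fh i * (norm (T (x i) - Th (x i)))\<^sup>2)
               \<le> C * sqrt lam * sqrt h))"
proof -
  define c where "c = 8 * C1 + C2"
  \<comment> \<open>The witness is fixed before \<open>lam\<close>, \<phi>, the carriers and all
    discrete data are introduced.\<close>
  define C where "C = 6 * C1 + sqrt (2 * (2 * (l2norm \<mu> (\<lambda>x. x) + l2norm \<nu> (\<lambda>y. y)) * c + c\<^sup>2))"
  show ?thesis
  proof (rule exI[of _ C], intro allI impI, unfold Let_def, intro allI impI, goal_cases)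
    case (1 lam \<phi> X Y h N M x y fh gh w)
    note [measurable] = measurable_fst_borel measurable_snd_borel
    let ?T = "gradient \<phi>"
    let ?\<mu>h = "discrete_measure {1..N} fh x" and ?\<nu>h = "discrete_measure {1..M} gh y"
    let ?\<gamma>h = "discrete_measure ({1..N} \<times> {1..M}) (\<lambda>(i, j). w i j) (\<lambda>(i, j). (x i, y j))"
    from 1 have lam: "lam > 0" and reg: "lambda_regular lam \<mu> \<nu> \<phi>"
      and XY: "X \<in> sets borel" "Y \<in> sets borel" by blast+
    from 1 have h: "0 < h" "h \<le> lam" "h \<le> inverse lam"
      and inj: "inj_on x {1..N}" and xX: "\<And>i. i \<in> {1..N} \<Longrightarrow> x i \<in> X"
      and yY: "\<And>j. j \<in> {1..M} \<Longrightarrow> y j \<in> Y"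
      and f: "\<And>i. i \<in> {1..N} \<Longrightarrow> fh i > 0"
      and prob: "prob_space ?\<mu>h" "prob_space ?\<nu>h"
      and W: "W2 \<mu> ?\<mu>h \<le> C1 * h" "W2 \<nu> ?\<nu>h \<le> C1 * h"
      and w: "\<And>i j. i \<in> {1..N} \<Longrightarrow> j \<in> {1..M} \<Longrightarrow> w i j \<ge> 0"
      and \<gamma>: "?\<gamma>h \<in> transport_plans ?\<mu>h ?\<nu>h"
      and opt: "sqrt (\<Sum>i=1..N. \<Sum>j=1..M. w i j * (norm (x i - y j))\<^sup>2) - W2 ?\<mu>h ?\<nu>h \<le> C2 * h"
      by auto
    interpret smooth_convex lam \<phi>
      using reg by unfold_locales (auto simp: lambda_regular_def)
    have \<nu>T: "distr \<mu> borel ?T = \<nu>"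
      using reg by (simp add: lambda_regular_def is_optimal_transport_map_def)
    have l2: "l2norm ?\<gamma>h F = sqrt (\<Sum>i=1..N. \<Sum>j=1..M. w i j * (norm (F (x i, y j)))\<^sup>2)"
      if "F \<in> borel_measurable borel" for F :: "_ \<Rightarrow> real ^ 'd"
      using that w by (subst l2norm_discrete_measure) (auto simp: sum.cartesian_product split_beta')
    have "l2norm ?\<gamma>h (\<lambda>z. fst z - snd z) - W2 ?\<mu>h ?\<nu>h \<le> C2 * h"
      using opt by (subst l2) simp_all
    note stab = plan_stability[OF assms(1,2) discrete_measure_P2[OF _ prob(1)] discrete_measure_P2[OF _ prob(2)]
      \<nu>T \<gamma> _ AE_discrete_measure _ AE_discrete_measure assms(9,10) h W this c_def C_def]
    have T\<gamma>: "l2norm ?\<gamma>h (\<lambda>z. ?T (fst z) - snd z) = sqrt (\<Sum>i=1..N. \<Sum>j=1..M. w i j * (norm (?T (x i) - y j))\<^sup>2)"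
      by (subst l2) simp_all
    have est: "sqrt (\<Sum>i=1..N. \<Sum>j=1..M. w i j * (norm (?T (x i) - y j))\<^sup>2) \<le> C * sqrt lam * sqrt h"
      using stab(1) unfolding T\<gamma> by simp
    \<comment> \<open>Measurability of the rectangle allows its indicator to be part of the
      integrand; every atom lies in it, so the restriction leaves the sum unchanged.\<close>
    have "X \<times> Y \<in> sets borel"
      using XY pair_measureI[of X borel Y borel] by (simp add: sets_borel_prod)
    then have "(LINT z:X \<times> Y|?\<gamma>h. (norm (?T (fst z) - snd z))\<^sup>2)
        = (\<Sum>p\<in>{1..N} \<times> {1..M}. (case p of (i, j) \<Rightarrow> w i j) *\<^sub>R
            (\<lambda>z. indicator (X \<times> Y) z *\<^sub>R (norm (?T (fst z) - snd z))\<^sup>2) (case p of (i, j) \<Rightarrow> (x i, y j)))"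
      unfolding set_lebesgue_integral_def
      using w by (intro integral_discrete_measure) auto
    also have "\<dots> = (\<Sum>i=1..N. \<Sum>j=1..M. w i j * (norm (?T (x i) - y j))\<^sup>2)"
      unfolding sum.cartesian_product using xX yY by (intro sum.cong) auto
    finally have int: "(LINT z:X \<times> Y|?\<gamma>h. (norm (?T (fst z) - snd z))\<^sup>2)
        = (\<Sum>i=1..N. \<Sum>j=1..M. w i j * (norm (?T (x i) - y j))\<^sup>2)" .
    have row: "(\<Sum>j=1..M. w i j) = fh i" if "i \<in> {1..N}" for i
      using discrete_plan_row_sum[of "{1..N}" "{1..M}" x i fh w y] inj that f w \<gamma>
      by (simp add: transport_plans_def less_imp_le)
    have "sqrt (\<Sum>i=1..N. fh i * (norm (?T (x i) - Th (x i)))\<^sup>2) \<le> C * sqrt lam * sqrt h"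
      if Th: "\<forall>i\<in>{1..N}. Th (x i) = (1 / fh i) *\<^sub>R (\<Sum>j=1..M. w i j *\<^sub>R y j)" for Th
    proof -
      have "(\<Sum>i=1..N. fh i * (norm (?T (x i) - Th (x i)))\<^sup>2)
          \<le> (\<Sum>i=1..N. \<Sum>j=1..M. w i j * (norm (?T (x i) - y j))\<^sup>2)"
      proof (rule sum_mono)
        fix i assume i: "i \<in> {1..N}"
        show "fh i * (norm (?T (x i) - Th (x i)))\<^sup>2 \<le> (\<Sum>j=1..M. w i j * (norm (?T (x i) - y j))\<^sup>2)"
          \<comment> \<open>Row \<open>i\<close> divided by \<open>fh i\<close> is the conditional
            law of the target given \<open>x i\<close>, and \<open>Th (x i)\<close> is its
            barycentre.\<close>
          using weighted_mean_deviation_le[OF w[OF i] row[OF i] f[OF i], of "?T (x i)" y] Th i by simp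
      qed
      then show ?thesis using est by (meson order_trans real_sqrt_le_mono)
    qed
    then show ?case
      using int est stab(2) by (auto intro: countable_finite)
  qed
qed

end
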